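(* There exists a path-connected, locally path-connected metric space $X$ that has well-defined transfinite $\pi_1$-products but does not have well-defined transfinite $\Pi_1$-products.
   Context: A path is a continuous map $[0,1]\to X$; $\alpha^{-}$ denotes the reverse of $\alpha$, $\cdot$ denotes concatenation, $[\alpha]$ denotes the path-homotopy class (rel. endpoints), and a restriction $\alpha|_{[a,b]}$ is regarded as a path via the increasing linear homeomorphism $[0,1]\to[a,b]$ (if $a=b$ it is a constant path). $f_\#$ is the homomorphism induced on $\pi_1$. Hawaiian earring with whisker: let $C_n\subseteq\mathbb{R}^2$ be the circle of radius $\frac1n$ centered at $(\frac1n,0)$, $\mathbb{H}=\bigcup_{n\in\mathbb{N}}C_n$, $b_0=(0,0)$, $\ell_n(t)=\left(\frac1n(1-\cos 2\pi t),-\frac1n\sin 2\pi t\right)$, $\mathbb{H}^{+}=\mathbb{H}\cup([-1,0]\times\{0\})$ with basepoint $b_0^{+}=(-1,0)$, $\iota:[0,1]\to\mathbb{H}^{+}$, $\iota(t)=(t-1,0)$, and $c_n=[\iota\cdot\ell_n\cdot\iota^{-}]\in\pi_1(\mathbb{H}^{+},b_0^{+})$. Let $X$ be a path-connected space with basepoint $x_0$. $X$ has well-defined transfinite $\pi_1$-products if for every pair of maps $a,b:(\mathbb{H}^{+},b_0^{+})\to(X,x_0)$ such that $a\circ\iota=b\circ\iota$ and $a_\#(c_n)=b_\#(c_n)$ for all $n\in\mathbb{N}$, we have $a_\#(g)=b_\#(g)$ for all $g\in\pi_1(\mathbb{H}^{+},b_0^{+})$. $X$ has well-defined transfinite $\Pi_1$-products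 if for every closed set $A\subseteq[0,1]$ containing $\{0,1\}$ and all paths $\alpha,\beta:([0,1],0)\to(X,x_0)$ such that $\alpha|_A=\beta|_A$ and $[\alpha|_{[0,b]}\cdot\beta|_{[a,b]}^{-}\cdot\alpha|_{[0,a]}^{-}]=1$ in $\pi_1(X,x_0)$ for every component $(a,b)$ of $[0,1]\setminus A$, we have $[\alpha\cdot\beta^{-}]=1$. *)

theory Defs
  imports "HOL-Analysis.Analysis" "HOL-Algebra.Group"
begin

section \<open>Paths in an abstract topological space\<close>

text \<open>Paths in \<open>X\<close> are functions \<open>real \<Rightarrow> 'a\<close> satisfying \<^const>\<open>pathin\<close>; their values outside
  \<open>[0,1]\<close> are irrelevant. The library operations \<open>joinpaths\<close>, \<open>reversepath\<close>, \<open>subpath\<close> and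
  \<open>homotopic_paths\<close> carry type class constraints on the codomain, so the same formulas are
  restated here for an arbitrary carrier type.\<close>

definition path_concat :: "(real \<Rightarrow> 'a) \<Rightarrow> (real \<Rightarrow> 'a) \<Rightarrow> real \<Rightarrow> 'a" where
  "path_concat p q = (\<lambda>t. if t \<le> 1/2 then p (2 * t) else q (2 * t - 1))"

definition path_reverse :: "(real \<Rightarrow> 'a) \<Rightarrow> real \<Rightarrow> 'a" where
  "path_reverse p = (\<lambda>t. p (1 - t))"

definition path_restrict :: "real \<Rightarrow> real \<Rightarrow> (real \<Rightarrow> 'a) \<Rightarrow> real \<Rightarrow> 'a" where
  "path_restrict a b p = (\<lambda>t. p ((b - a) * t + a))"

definition path_homotopic :: "'a topology \<Rightarrow> (real \<Rightarrow> 'a) \<Rightarrow> (real \<Rightarrow> 'a) \<Rightarrow> bool" where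
  "path_homotopic X p q \<longleftrightarrow>
     homotopic_with (\<lambda>r. r 0 = p 0 \<and> r 1 = p 1) (top_of_set {0..1}) X p q"

definition path_class :: "'a topology \<Rightarrow> (real \<Rightarrow> 'a) \<Rightarrow> (real \<Rightarrow> 'a) set" where
  "path_class X p = {q. path_homotopic X p q}"


section \<open>The fundamental group and induced homomorphisms\<close>

definition fundamental_group :: "'a topology \<Rightarrow> 'a \<Rightarrow> (real \<Rightarrow> 'a) set monoid" where
  "fundamental_group X x0 =
     \<lparr>carrier = {path_class X p | p. pathin X p \<and> p 0 = x0 \<and> p 1 = x0},
      mult = (\<lambda>U V. \<Union>p\<in>U. \<Union>q\<in>V. path_class X (path_concat p q)),
      one = path_class X (\<lambda>_. x0)\<rparr>"

text \<open>The map \<open>f\<^sub>#\<close>, for \<open>f\<close> a continuous map into \<open>Y\<close>. All the classes in the union coincide when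
  \<open>U\<close> is a path class, so the value is the class of \<open>f \<circ> p\<close> for any \<open>p\<close> in \<open>U\<close>.\<close>

definition induced_map :: "'b topology \<Rightarrow> ('a \<Rightarrow> 'b) \<Rightarrow> (real \<Rightarrow> 'a) set \<Rightarrow> (real \<Rightarrow> 'b) set" where
  "induced_map Y f U = (\<Union>p\<in>U. path_class Y (f \<circ> p))"


section \<open>The Hawaiian earring with a whisker\<close>

text \<open>The type \<open>real \<times> real\<close> carries the Euclidean metric. The index set of the circles is
  \<open>n \<ge> 1\<close>.\<close>

definition hawaiian_earring :: "(real \<times> real) set" where
  "hawaiian_earring = (\<Union>n\<in>{1::nat..}. sphere (1 / real n, 0) (1 / real n))"

definition hawaiian_loop :: "nat \<Rightarrow> real \<Rightarrow> real \<times> real" where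
  "hawaiian_loop n t = (1 / real n * (1 - cos (2 * pi * t)), - (1 / real n) * sin (2 * pi * t))"

definition whiskered_earring :: "(real \<times> real) topology" where
  "whiskered_earring = top_of_set (hawaiian_earring \<union> {-1..0} \<times> {0})"

definition whisker_base :: "real \<times> real" where
  "whisker_base = (-1, 0)"

definition whisker :: "real \<Rightarrow> real \<times> real" where
  "whisker t = (t - 1, 0)"

definition whisker_class :: "nat \<Rightarrow> (real \<Rightarrow> real \<times> real) set" where
  "whisker_class n = path_class whiskered_earring
     (path_concat (path_concat whisker (hawaiian_loop n)) (path_reverse whisker))"


section \<open>Well-defined transfinite products\<close>

definition pointed_map :: "'a topology \<Rightarrow> 'a \<Rightarrow> 'b topology \<Rightarrow> 'b \<Rightarrow> ('a \<Rightarrow> 'b) \<Rightarrow> bool" where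
  "pointed_map X x0 Y y0 f \<longleftrightarrow> continuous_map X Y f \<and> f x0 = y0"

definition well_defined_transfinite_pi1_products :: "'a topology \<Rightarrow> 'a \<Rightarrow> bool" where
  "well_defined_transfinite_pi1_products X x0 \<longleftrightarrow>
     (\<forall>a b. pointed_map whiskered_earring whisker_base X x0 a \<and>
            pointed_map whiskered_earring whisker_base X x0 b \<and>
            (\<forall>t\<in>{0..1}. a (whisker t) = b (whisker t)) \<and>
            (\<forall>n\<ge>1. induced_map X a (whisker_class n) = induced_map X b (whisker_class n))
        \<longrightarrow> (\<forall>g \<in> carrier (fundamental_group whiskered_earring whisker_base).
               induced_map X a g = induced_map X b g))"

text \<open>For closed \<open>A\<close> containing \<open>0\<close> and \<open>1\<close>, every component of \<open>{0..1} - A\<close> is an open interval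
  \<open>{a<..<b}\<close> with \<open>a < b\<close> in \<open>A\<close>, so quantifying over such intervals covers all components.\<close>

definition well_defined_transfinite_Pi1_products :: "'a topology \<Rightarrow> 'a \<Rightarrow> bool" where
  "well_defined_transfinite_Pi1_products X x0 \<longleftrightarrow>
     (\<forall>A \<alpha> \<beta>. closed A \<and> A \<subseteq> {0..1} \<and> {0, 1} \<subseteq> A \<and>
            pathin X \<alpha> \<and> \<alpha> 0 = x0 \<and> pathin X \<beta> \<and> \<beta> 0 = x0 \<and>
            (\<forall>t\<in>A. \<alpha> t = \<beta> t) \<and>
            (\<forall>a b. {a<..<b} \<in> components ({0..1} - A) \<longrightarrow>
               path_class X (path_concat (path_concat (path_restrict 0 b \<alpha>)
                                                      (path_reverse (path_restrict a b \<beta>)))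
                                         (path_reverse (path_restrict 0 a \<alpha>)))
               = \<one>\<^bsub>fundamental_group X x0\<^esub>)
        \<longrightarrow> path_class X (path_concat \<alpha> (path_reverse \<beta>)) = \<one>\<^bsub>fundamental_group X x0\<^esub>)"

end

(* The space X consists of pairs (z, phi) of a point z of the plane and a bounded height function
   phi on a countable set of punctures, where the puncture p n may be occupied only if phi n >= 1
   and the support of phi must belong to an ideal of "thin" sets of punctures. Lifting phi is always
   possible, and a compact subset of X only occupies a thin set of punctures; so loops in X are
   homotopic iff their shadows (the z-components) are homotopic in the plane with a thin set of punctures filled in.

   The punctures lie above a closed set A of positive measure without rational points in (0,1), one
   over each rational, and a set of punctures is thin if its limit points in A have measure 0.
   Thin sets shrinking to a point have a thin union, and null homotopies of small loops may be
   retracted to small squares: hence transfinite pi1-products are well defined. Between the segment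
   [0,1] and the graph of the distance to A, the punctures over a single gap of A are thin, but all
   punctures together are not: hence transfinite Pi1-products are not well defined. *)
theory Submission
  imports Defs
begin

section \<open>Path homotopy in abstract spaces\<close>

lemma path_homotopic_canon:
  "path_homotopic (top_of_set S) p q \<longleftrightarrow> homotopic_paths S p q"
  by (simp add: path_homotopic_def homotopic_paths_def pathstart_def pathfinish_def)

lemma path_homotopic_refl: "path_homotopic X p p \<longleftrightarrow> pathin X p"
  by (auto simp: path_homotopic_def pathin_def)

lemma path_homotopic_sym: "path_homotopic X p q \<Longrightarrow> path_homotopic X q p"
  unfolding path_homotopic_def
  by (smt (verit) homotopic_with_imp_property homotopic_with_mono homotopic_with_symD)

lemma path_homotopic_imp_ends:
  assumes "path_homotopic X p q"
  shows "q 0 = p 0 \<and> q 1 = p 1"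
  using homotopic_with_imp_property[OF assms[unfolded path_homotopic_def]] by simp

lemma path_homotopic_trans:
  assumes "path_homotopic X p q" "path_homotopic X q r"
  shows "path_homotopic X p r"
proof -
  have "q 0 = p 0 \<and> q 1 = p 1"
    using assms(1) by (rule path_homotopic_imp_ends)
  then show ?thesis
    using assms unfolding path_homotopic_def by (auto intro: homotopic_with_trans)
qed


lemma path_class_eq_iff:
  assumes "pathin X p"
  shows "path_class X p = path_class X q \<longleftrightarrow> path_homotopic X p q"
proof
  assume "path_class X p = path_class X q"
  moreover have "p \<in> path_class X p"
    using assms by (simp add: path_class_def path_homotopic_refl)
  ultimately show "path_homotopic X p q"
    by (simp add: path_class_def path_homotopic_sym)
next
  assume "path_homotopic X p q"
  then show "path_class X p = path_class X q"
    unfolding path_class_def using path_homotopic_sym path_homotopic_trans by blast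
qed

lemma path_homotopic_compose:
  assumes "path_homotopic X p q" "continuous_map X Y f"
  shows "path_homotopic Y (f \<circ> p) (f \<circ> q)"
  using assms unfolding path_homotopic_def
  by (auto intro: homotopic_with_compose_continuous_map_left)

lemma path_homotopic_cong:
  assumes "path_homotopic X p q" "\<And>t. t \<in> {0..1} \<Longrightarrow> p' t = p t" "\<And>t. t \<in> {0..1} \<Longrightarrow> q' t = q t"
  shows "path_homotopic X p' q'"
  using assms unfolding path_homotopic_def
  by (auto intro: homotopic_with_eq[where f = p and g = q])

lemma induced_map_path_class:
  assumes "pathin X p" "continuous_map X Y f"
  shows "induced_map Y f (path_class X p) = path_class Y (f \<circ> p)"
proof -
  have "path_class Y (f \<circ> q) = path_class Y (f \<circ> p)" if "path_homotopic X p q" for q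
  proof -
    have "path_homotopic Y (f \<circ> p) (f \<circ> q)"
      by (rule path_homotopic_compose[OF that assms(2)])
    then show ?thesis
      using path_class_eq_iff[OF pathin_compose[OF assms]] by metis
  qed
  moreover have "p \<in> path_class X p"
    using assms by (simp add: path_class_def path_homotopic_refl)
  ultimately show ?thesis
    unfolding induced_map_def path_class_def by blast
qed

lemma path_homotopic_homeomorphic:
  assumes hom: "homeomorphic_maps X Y f g" and "pathin X p" "pathin X q"
  shows "path_homotopic X p q \<longleftrightarrow> path_homotopic Y (f \<circ> p) (f \<circ> q)"
proof
  assume "path_homotopic X p q"
  then show "path_homotopic Y (f \<circ> p) (f \<circ> q)"
    using hom by (simp add: homeomorphic_maps_def path_homotopic_compose)
next
  assume "path_homotopic Y (f \<circ> p) (f \<circ> q)"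
  moreover have "continuous_map Y X g"
    using hom by (simp add: homeomorphic_maps_def)
  ultimately have "path_homotopic X (g \<circ> (f \<circ> p)) (g \<circ> (f \<circ> q))"
    by (rule path_homotopic_compose)
  moreover have "g (f (p t)) = p t" "g (f (q t)) = q t" if "t \<in> {0..1}" for t
    using assms that by (auto simp: homeomorphic_maps_def pathin_def continuous_map_def Pi_iff)
  ultimately show "path_homotopic X p q"
    using path_homotopic_cong[of X _ _ p q] by simp
qed

definition whisker_loop :: "nat \<Rightarrow> real \<Rightarrow> real \<times> real" where
  "whisker_loop n = path_concat (path_concat whisker (hawaiian_loop n)) (path_reverse whisker)"

abbreviation "whiskered_set \<equiv> hawaiian_earring \<union> {-1..0} \<times> {0}"

lemma path_concat_joinpaths: "path_concat p q = p +++ q"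
  by (auto simp: path_concat_def joinpaths_def)

lemma path_reverse_reversepath: "path_reverse p = reversepath p"
  by (auto simp: path_reverse_def reversepath_def)

lemma path_restrict_subpath: "path_restrict a b p = subpath a b p"
  by (auto simp: path_restrict_def subpath_def)

lemma path_hawaiian_loop: "path (hawaiian_loop n)"
  unfolding path_def hawaiian_loop_def by (intro continuous_intros)

lemma path_whisker: "path whisker"
  unfolding path_def whisker_def by (intro continuous_intros)

lemma hawaiian_loop_ends [simp]: "hawaiian_loop n 0 = 0" "hawaiian_loop n 1 = 0"
  by (auto simp: hawaiian_loop_def zero_prod_def)

lemma ends_whisker [simp]: "pathstart whisker = (-1, 0)" "pathfinish whisker = 0"
  and ends_hawaiian_loop [simp]: "pathstart (hawaiian_loop n) = 0" "pathfinish (hawaiian_loop n) = 0"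
  by (auto simp: whisker_def pathstart_def pathfinish_def zero_prod_def)

lemma hawaiian_loop_in_sphere:
  assumes "n \<ge> 1"
  shows "hawaiian_loop n t \<in> sphere (1 / real n, 0) (1 / real n)"
proof -
  have "(cos (2 * pi * t) / n)\<^sup>2 + (sin (2 * pi * t) / n)\<^sup>2 = (1 / real n)\<^sup>2"
    by (simp add: power_divide flip: add_divide_distrib)
  moreover have "1 / n - 1 / n * (1 - cos (2 * pi * t)) = cos (2 * pi * t) / n"
    by (simp add: algebra_simps diff_divide_distrib)
  ultimately have "dist (1 / real n, 0::real) (hawaiian_loop n t) = sqrt ((1 / real n)\<^sup>2)"
    unfolding hawaiian_loop_def dist_Pair_Pair dist_real_def power2_abs by simp
  then show ?thesis
    by simp
qed

lemma hawaiian_loop_in_earring: "n \<ge> 1 \<Longrightarrow> hawaiian_loop n t \<in> hawaiian_earring"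
  unfolding hawaiian_earring_def using hawaiian_loop_in_sphere by force

lemma whisker_loop_joinpaths: "whisker_loop n = (whisker +++ hawaiian_loop n) +++ reversepath whisker"
  by (simp add: whisker_loop_def path_concat_joinpaths path_reverse_reversepath)

lemma pathin_whisker_loop:
  assumes "n \<ge> 1"
  shows "pathin whiskered_earring (whisker_loop n)"
proof -
  have "path (whisker_loop n)"
    unfolding whisker_loop_joinpaths
    by (simp add: path_hawaiian_loop path_whisker)
  moreover have "path_image (whisker_loop n) \<subseteq> whiskered_set"
    unfolding whisker_loop_joinpaths
    by (intro subset_path_image_join)
      (use hawaiian_loop_in_earring[OF assms] in \<open>auto simp: path_image_def whisker_def reversepath_def\<close>)
  ultimately show ?thesis
    unfolding whiskered_earring_def by (auto simp: pathin_def path_def path_image_def)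
qed

lemma well_defined_transfinite_pi1_productsI:
  assumes "\<And>a b p. \<lbrakk>continuous_map whiskered_earring X a; continuous_map whiskered_earring X b;
      \<And>t. t \<in> {0..1} \<Longrightarrow> a (whisker t) = b (whisker t);
      \<And>n. n \<ge> 1 \<Longrightarrow> path_homotopic X (a \<circ> whisker_loop n) (b \<circ> whisker_loop n);
      pathin whiskered_earring p; p 0 = whisker_base; p 1 = whisker_base\<rbrakk>
      \<Longrightarrow> path_homotopic X (a \<circ> p) (b \<circ> p)"
  shows "well_defined_transfinite_pi1_products X x0"
  unfolding well_defined_transfinite_pi1_products_def
proof (intro allI impI ballI)
  fix a b g
  assume H: "pointed_map whiskered_earring whisker_base X x0 a \<and>
            pointed_map whiskered_earring whisker_base X x0 b \<and>
            (\<forall>t\<in>{0..1}. a (whisker t) = b (whisker t)) \<and>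
            (\<forall>n\<ge>1. induced_map X a (whisker_class n) = induced_map X b (whisker_class n))"
    and g: "g \<in> carrier (fundamental_group whiskered_earring whisker_base)"
  have a: "continuous_map whiskered_earring X a" and b: "continuous_map whiskered_earring X b"
    using H by (auto simp: pointed_map_def)
  obtain p where p: "g = path_class whiskered_earring p" "pathin whiskered_earring p"
      "p 0 = whisker_base" "p 1 = whisker_base"
    using g by (auto simp: fundamental_group_def)
  have "path_homotopic X (a \<circ> whisker_loop n) (b \<circ> whisker_loop n)" if "n \<ge> 1" for n
  proof -
    have "induced_map X a (whisker_class n) = induced_map X b (whisker_class n)"
      using H that by blast
    moreover have "whisker_class n = path_class whiskered_earring (whisker_loop n)"
      by (simp add: whisker_class_def whisker_loop_def)
    ultimately have "path_class X (a \<circ> whisker_loop n) = path_class X (b \<circ> whisker_loop n)"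
      using induced_map_path_class[OF pathin_whisker_loop[OF that] a]
        induced_map_path_class[OF pathin_whisker_loop[OF that] b] by simp
    then show ?thesis
      using path_class_eq_iff[OF pathin_compose[OF pathin_whisker_loop[OF that] a]] by simp
  qed
  then have "path_homotopic X (a \<circ> p) (b \<circ> p)"
    by (intro assms[OF a b _ _ p(2-4)]) (use H in auto)
  then show "induced_map X a g = induced_map X b g"
    using induced_map_path_class[OF p(2) a] induced_map_path_class[OF p(2) b]
      path_class_eq_iff[OF pathin_compose[OF p(2) a]]
    by (simp add: p(1))
qed

lemma not_well_defined_transfinite_Pi1_productsI:
  assumes "closed A" "A \<subseteq> {0..1}" "{0, 1} \<subseteq> A"
    and "pathin X \<alpha>" "\<alpha> 0 = x0" "pathin X \<beta>" "\<beta> 0 = x0" "\<And>t. t \<in> A \<Longrightarrow> \<alpha> t = \<beta> t"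
    and "\<And>a b. {a<..<b} \<in> components ({0..1} - A) \<Longrightarrow>
       path_homotopic X ((subpath 0 b \<alpha> +++ reversepath (subpath a b \<beta>)) +++ reversepath (subpath 0 a \<alpha>)) (\<lambda>_. x0)"
    and "\<not> path_homotopic X (\<alpha> +++ reversepath \<beta>) (\<lambda>_. x0)"
  shows "\<not> well_defined_transfinite_Pi1_products X x0"
proof -
  have "x0 \<in> topspace X"
    using assms(4,5) by (force simp: pathin_def continuous_map_def)
  then have c: "pathin X (\<lambda>_. x0)"
    by (simp add: pathin_def)
  have eq: "path_class X q = \<one>\<^bsub>fundamental_group X x0\<^esub> \<longleftrightarrow> path_homotopic X q (\<lambda>_. x0)" for q
  proof -
    have "path_class X q = \<one>\<^bsub>fundamental_group X x0\<^esub> \<longleftrightarrow> path_class X (\<lambda>_. x0) = path_class X q"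
      by (auto simp: fundamental_group_def)
    also have "\<dots> \<longleftrightarrow> path_homotopic X q (\<lambda>_. x0)"
      unfolding path_class_eq_iff[OF c] using path_homotopic_sym[of X] by blast
    finally show ?thesis .
  qed
  show ?thesis
    unfolding well_defined_transfinite_Pi1_products_def eq
      path_concat_joinpaths path_reverse_reversepath path_restrict_subpath not_all
    by (rule exI[of _ A], rule exI[of _ \<alpha>], rule exI[of _ \<beta>]) (use assms in blast)
qed

lemma nat_real_functions_inject:
  obtains f :: "(nat \<Rightarrow> real) \<Rightarrow> real" where "inj f"
proof -
  obtain s :: "real \<Rightarrow> nat set" where s: "inj s"
    using nat_sets_eqpoll_reals eqpoll_sym unfolding eqpoll_def bij_betw_def by metis
  obtain r :: "nat set \<Rightarrow> real" where r: "inj r"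
    using nat_sets_eqpoll_reals unfolding eqpoll_def bij_betw_def by metis
  define e where "e = (\<lambda>u::nat \<Rightarrow> real. prod_encode ` (SIGMA n:UNIV. s (u n)))"
  have "inj e"
  proof (rule injI)
    fix u v assume "e u = e v"
    then have eq: "(SIGMA n:UNIV. s (u n)) = (SIGMA n:UNIV. s (v n))"
      unfolding e_def inj_image_eq_iff[OF inj_prod_encode] .
    have "s (u n) = s (v n)" for n
      using arg_cong[OF eq, of "\<lambda>r. r `` {n}"] by auto
    then show "u = v"
      using s by (auto simp: inj_def)
  qed
  then show thesis
    using that[of "r \<circ> e"] r inj_compose by blast
qed

lemma metric_copy_on_reals:
  fixes S :: "'a::metric_space set" and j :: "'a \<Rightarrow> real"
  assumes j: "inj_on j S"
  obtains M :: "real metric" where "mspace M = j ` S"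
    "homeomorphic_maps (mtopology_of M) (top_of_set S) (inv_into S j) j"
proof -
  define i where "i = inv_into S j"
  have i: "i (j x) = x" if "x \<in> S" for x
    using that j by (simp add: i_def)
  have "Metric_space (j ` S) (\<lambda>r s. dist (i r) (i s))"
    by unfold_locales (auto simp: i dist_commute dist_triangle dest: arg_cong[where f = j])
  then interpret Metric_space "j ` S" "\<lambda>r s. dist (i r) (i s)" .
  define M where "M = metric (j ` S, \<lambda>r s. dist (i r) (i s))"
  have top: "mtopology_of M = mtopology"
    by (simp add: M_def mtopology_of_def mspace_metric mdist_metric)
  interpret E: Metric_space S dist
    by unfold_locales (auto simp: dist_commute dist_triangle)
  have E: "E.mtopology = top_of_set S"
  proof -
    interpret Submetric UNIV dist S
      by unfold_locales simp
    show ?thesis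
      using mtopology_submetric by simp
  qed
  have "continuous_map mtopology E.mtopology i"
    by (auto simp: metric_continuous_map[OF E.Metric_space_axioms] i)
  moreover have "continuous_map E.mtopology mtopology j"
    by (auto simp: E.metric_continuous_map[OF Metric_space_axioms] i)
  ultimately have "homeomorphic_maps mtopology E.mtopology i j"
    by (auto simp: homeomorphic_maps_def i)
  then have "homeomorphic_maps (mtopology_of M) (top_of_set S) (inv_into S j) j"
    unfolding top E[symmetric] i_def[symmetric] .
  moreover have "mspace M = j ` S"
    by (simp add: M_def)
  ultimately show thesis
    using that by blast
qed

section \<open>The tower over a punctured plane\<close>

locale puncture_ideal =
  fixes p :: "nat \<Rightarrow> complex" and I :: "nat set set"
  assumes empty_in_ideal: "{} \<in> I"
    and ideal_subset: "\<lbrakk>S \<in> I; T \<subseteq> S\<rbrakk> \<Longrightarrow> T \<in> I"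
    and ideal_Un: "\<lbrakk>S \<in> I; T \<in> I\<rbrakk> \<Longrightarrow> S \<union> T \<in> I"
    and ideal_null_Union: "\<lbrakk>\<And>k. F k \<in> I; \<And>e. e > 0 \<Longrightarrow> \<forall>\<^sub>F k in sequentially. p ` F k \<subseteq> ball z e\<rbrakk>
      \<Longrightarrow> (\<Union>k. F k) \<in> I"
begin

definition tower :: "(complex \<times> (nat \<Rightarrow>\<^sub>C real)) set" where
  "tower = {(z, \<phi>). {n. apply_bcontfun \<phi> n \<noteq> 0} \<in> I \<and> (\<forall>n. p n = z \<longrightarrow> 1 \<le> apply_bcontfun \<phi> n)}"

definition plane :: "nat set \<Rightarrow> complex set" where
  "plane W = - p ` (- W)"

definition sheet :: "nat set \<Rightarrow> nat \<Rightarrow>\<^sub>C real" where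
  "sheet W = Bcontfun (\<lambda>n. of_bool (n \<in> W))"

lemma sheet_apply [simp]: "apply_bcontfun (sheet W) n = of_bool (n \<in> W)"
proof -
  have "(\<lambda>n. of_bool (n \<in> W)) \<in> (bcontfun :: (nat \<Rightarrow> real) set)"
    by (rule bcontfun_normI[where b = 1]) (auto simp: continuous_on_discrete)
  then show ?thesis
    by (simp add: sheet_def Bcontfun_inverse)
qed

lemma supp_sheet [simp]: "{n. apply_bcontfun (sheet W) n \<noteq> 0} = W"
  by auto

lemma mem_tower:
  "(z, \<phi>) \<in> tower \<longleftrightarrow> {n. apply_bcontfun \<phi> n \<noteq> 0} \<in> I \<and> (\<forall>n. p n = z \<longrightarrow> 1 \<le> apply_bcontfun \<phi> n)"
  by (simp add: tower_def)

lemma sheet_in_tower: "\<lbrakk>W \<in> I; z \<in> plane W\<rbrakk> \<Longrightarrow> (z, sheet W) \<in> tower"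
  by (auto simp: mem_tower plane_def)

lemma ideal_finite_UN: "\<lbrakk>finite F; \<And>x. x \<in> F \<Longrightarrow> f x \<in> I\<rbrakk> \<Longrightarrow> (\<Union>x\<in>F. f x) \<in> I"
  by (induction F rule: finite_induct) (auto simp: empty_in_ideal ideal_Un)

lemma tower_fibre_convex:
  assumes "(z, \<phi>) \<in> tower" "(z, \<psi>) \<in> tower" "0 \<le> u" "u \<le> 1"
  shows "(z, (1 - u) *\<^sub>R \<phi> + u *\<^sub>R \<psi>) \<in> tower"
proof -
  have "{n. apply_bcontfun ((1 - u) *\<^sub>R \<phi> + u *\<^sub>R \<psi>) n \<noteq> 0}
      \<subseteq> {n. apply_bcontfun \<phi> n \<noteq> 0} \<union> {n. apply_bcontfun \<psi> n \<noteq> 0}"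
    by auto
  moreover have "{n. apply_bcontfun \<phi> n \<noteq> 0} \<union> {n. apply_bcontfun \<psi> n \<noteq> 0} \<in> I"
    using assms ideal_Un by (auto simp: mem_tower)
  moreover have "1 \<le> apply_bcontfun ((1 - u) *\<^sub>R \<phi> + u *\<^sub>R \<psi>) n" if "p n = z" for n
  proof -
    have "(1 - u) * 1 + u * 1 \<le> (1 - u) * apply_bcontfun \<phi> n + u * apply_bcontfun \<psi> n"
      using assms that by (intro add_mono mult_left_mono) (auto simp: mem_tower)
    then show ?thesis
      by simp
  qed
  ultimately show ?thesis
    using ideal_subset by (auto simp: mem_tower)
qed

lemma segment_in_tower:
  assumes "x \<in> tower" "y \<in> tower" "fst x = fst y"
  shows "closed_segment x y \<subseteq> tower"
proof -
  obtain z \<phi> \<psi> where "x = (z, \<phi>)" "y = (z, \<psi>)"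
    using assms(3) by (metis prod.collapse)
  then show ?thesis
    using tower_fibre_convex assms
    by (auto simp: closed_segment_def scaleR_prod_def plus_prod_def simp flip: scaleR_left_distrib)
qed

lemma homotopic_paths_same_shadow:
  assumes "path c" "path d" "path_image c \<subseteq> tower" "path_image d \<subseteq> tower"
    and "pathstart d = pathstart c" "pathfinish d = pathfinish c"
    and "\<And>t. t \<in> {0..1} \<Longrightarrow> fst (c t) = fst (d t)"
  shows "homotopic_paths tower c d"
  using assms by (intro homotopic_paths_linear segment_in_tower) (auto simp: path_image_def)

text \<open>By total boundedness, the supports of finitely many height functions contain all punctures
  occupied over a compact set.\<close>
lemma compact_hits_in_ideal:
  assumes "compact C" "C \<subseteq> tower"
  shows "{n. p n \<in> fst ` C} \<in> I"
proof -
  have "compact (snd ` C)"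
    using assms by (intro compact_continuous_image continuous_intros)
  then obtain F where F: "finite F" "F \<subseteq> snd ` C" "snd ` C \<subseteq> (\<Union>\<phi>\<in>F. ball \<phi> 1)"
    using seq_compact_imp_totally_bounded[OF compact_imp_seq_compact, rule_format, of "snd ` C" 1] by auto
  have "{n. p n \<in> fst ` C} \<subseteq> (\<Union>\<phi>\<in>F. {n. apply_bcontfun \<phi> n \<noteq> 0})"
  proof
    fix n assume "n \<in> {n. p n \<in> fst ` C}"
    then obtain \<psi> where \<psi>: "(p n, \<psi>) \<in> C"
      by force
    then obtain \<phi> where \<phi>: "\<phi> \<in> F" "dist \<phi> \<psi> < 1"
      using F(3) by force
    have "1 \<le> apply_bcontfun \<psi> n"
      using \<psi> assms by (auto simp: mem_tower)
    moreover have "dist (apply_bcontfun \<phi> n) (apply_bcontfun \<psi> n) < 1"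
      using \<phi> dist_bounded le_less_trans by blast
    ultimately have "apply_bcontfun \<phi> n \<noteq> 0"
      by (auto simp: dist_real_def)
    then show "n \<in> (\<Union>\<phi>\<in>F. {n. apply_bcontfun \<phi> n \<noteq> 0})"
      using \<phi> by blast
  qed
  moreover have "(\<Union>\<phi>\<in>F. {n. apply_bcontfun \<phi> n \<noteq> 0}) \<in> I"
  proof (rule ideal_finite_UN[OF F(1)])
    fix \<phi> assume "\<phi> \<in> F"
    then obtain x where "x \<in> tower" "snd x = \<phi>"
      using F(2) assms(2) by blast
    then show "{n. apply_bcontfun \<phi> n \<noteq> 0} \<in> I"
      by (auto simp: tower_def)
  qed
  ultimately show ?thesis
    using ideal_subset by blast
qed

lemma homotopic_paths_shadow:
  assumes "homotopic_paths tower c d"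
  obtains W where "W \<in> I" "homotopic_paths (plane W) (fst \<circ> c) (fst \<circ> d)"
proof -
  obtain h where h: "continuous_on ({0..1} \<times> {0..1}) h" "h \<in> ({0..1} \<times> {0..1}) \<rightarrow> tower"
    "\<forall>x\<in>{0..1}. h (0, x) = c x" "\<forall>x\<in>{0..1}. h (1, x) = d x"
    "\<forall>t\<in>{0..1::real}. pathstart (h \<circ> Pair t) = pathstart c \<and> pathfinish (h \<circ> Pair t) = pathfinish c"
    using assms unfolding homotopic_paths by blast
  define C where "C = h ` ({0..1} \<times> {0..1})"
  define W where "W = {n. p n \<in> fst ` C}"
  have "compact C"
    unfolding C_def by (intro compact_continuous_image h compact_Times) auto
  then have "W \<in> I"
    unfolding W_def using h(2) by (intro compact_hits_in_ideal) (auto simp: C_def)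
  moreover have "homotopic_paths C c d"
    unfolding homotopic_paths using h by (intro exI[of _ h]) (auto simp: C_def)
  then have "homotopic_paths (plane W) (fst \<circ> c) (fst \<circ> d)"
    by (rule homotopic_paths_continuous_image)
      (force simp: W_def plane_def intro!: continuous_intros)+
  ultimately show thesis
    using that by blast
qed

text \<open>Pad \<open>c\<close> by constant paths; over the padded shadow, the fibres being convex, the constant
  paths can be replaced by segments going up to \<open>sheet W\<close> and \<open>c\<close> by its lift to that sheet.\<close>
lemma homotopic_paths_via_sheet:
  assumes c: "path c" "path_image c \<subseteq> tower" and W: "W \<in> I" "fst ` path_image c \<subseteq> plane W"
  shows "homotopic_paths tower c
    ((linepath (pathstart c) (fst (pathstart c), sheet W) +++ (\<lambda>t. (fst (c t), sheet W)))
      +++ linepath (fst (pathfinish c), sheet W) (pathfinish c))"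
    (is "homotopic_paths tower c ((?up +++ ?lift) +++ ?down)")
proof -
  have "path ?lift"
    using c unfolding path_def by (intro continuous_intros)
  moreover have lift: "(fst x, sheet W) \<in> tower" if "x \<in> path_image c" for x
    using W that by (intro sheet_in_tower) auto
  then have "path_image ?lift \<subseteq> tower"
    unfolding path_image_def by blast
  moreover have cin: "pathstart c \<in> tower" "pathfinish c \<in> tower"
    using c by auto
  then have "path_image ?up \<subseteq> tower \<and> path_image ?down \<subseteq> tower"
    unfolding path_image_linepath using c lift[OF pathstart_in_path_image] lift[OF pathfinish_in_path_image]
    by (intro conjI segment_in_tower) auto
  moreover have ends: "pathstart ?lift = (fst (pathstart c), sheet W)"
      "pathfinish ?lift = (fst (pathfinish c), sheet W)"
    by (auto simp: pathstart_def pathfinish_def)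
  ultimately have rhs: "path ((?up +++ ?lift) +++ ?down)" "path_image ((?up +++ ?lift) +++ ?down) \<subseteq> tower"
    by (simp_all add: subset_path_image_join)
  let ?l = "linepath (pathstart c) (pathstart c)" and ?r = "linepath (pathfinish c) (pathfinish c)"
  have lc: "path (?l +++ c)" "path_image (?l +++ c) \<subseteq> tower"
    using c cin by (simp_all add: subset_path_image_join)
  have "homotopic_paths tower c (?l +++ c)"
    using c by (simp add: homotopic_paths_lid homotopic_paths_sym)
  also have "homotopic_paths tower \<dots> ((?l +++ c) +++ ?r)"
    using homotopic_paths_rid[OF lc] by (simp add: homotopic_paths_sym)
  also have "homotopic_paths tower \<dots> ((?up +++ ?lift) +++ ?down)"
  proof (rule homotopic_paths_same_shadow[OF _ rhs(1) _ rhs(2)])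
    show "path ((?l +++ c) +++ ?r)" "path_image ((?l +++ c) +++ ?r) \<subseteq> tower"
      using lc cin by (simp_all add: subset_path_image_join)
    show "fst (((?l +++ c) +++ ?r) t) = fst (((?up +++ ?lift) +++ ?down) t)" if "t \<in> {0..1}" for t
      by (auto simp: joinpaths_def linepath_def algebra_simps simp flip: scaleR_left_distrib)
  qed auto
  finally show ?thesis .
qed

lemma homotopic_paths_tower:
  assumes c: "path c" "path_image c \<subseteq> tower" and d: "path d" "path_image d \<subseteq> tower"
    and ends: "pathstart d = pathstart c" "pathfinish d = pathfinish c"
    and W: "W \<in> I" and hom: "homotopic_paths (plane W) (fst \<circ> c) (fst \<circ> d)"
  shows "homotopic_paths tower c d"
proof -
  have sub: "fst ` path_image c \<subseteq> plane W" "fst ` path_image d \<subseteq> plane W"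
    using homotopic_paths_imp_subset[OF hom] by (auto simp: path_image_def)
  have "homotopic_paths tower ((\<lambda>z. (z, sheet W)) \<circ> (fst \<circ> c)) ((\<lambda>z. (z, sheet W)) \<circ> (fst \<circ> d))"
    using hom by (rule homotopic_paths_continuous_image)
      (auto intro!: continuous_intros sheet_in_tower W)
  then have lift: "homotopic_paths tower (\<lambda>t. (fst (c t), sheet W)) (\<lambda>t. (fst (d t), sheet W))"
    by (simp add: o_def)
  note via = homotopic_paths_via_sheet[OF c W sub(1)] homotopic_paths_via_sheet[OF d W sub(2)]
  let ?up = "linepath (pathstart c) (fst (pathstart c), sheet W)"
  let ?down = "linepath (fst (pathfinish c), sheet W) (pathfinish c)"
  have ends': "pathstart (\<lambda>t. (fst (c t), sheet W)) = (fst (pathstart c), sheet W)"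
      "pathfinish (\<lambda>t. (fst (c t), sheet W)) = (fst (pathfinish c), sheet W)"
    by (auto simp: pathstart_def pathfinish_def)
  have cin: "pathstart c \<in> tower" "pathfinish c \<in> tower"
    using c by auto
  have up: "(fst x, sheet W) \<in> tower" if "x \<in> path_image c" for x
    using sub that by (intro sheet_in_tower W) auto
  then have "path_image ?up \<subseteq> tower \<and> path_image ?down \<subseteq> tower"
    unfolding path_image_linepath using cin up[OF pathstart_in_path_image] up[OF pathfinish_in_path_image]
    by (intro conjI segment_in_tower) auto
  then have "homotopic_paths tower
      ((?up +++ (\<lambda>t. (fst (c t), sheet W))) +++ ?down) ((?up +++ (\<lambda>t. (fst (d t), sheet W))) +++ ?down)"
    using lift ends' by (intro homotopic_paths_join) auto
  then show ?thesis
    using via unfolding ends by (meson homotopic_paths_sym homotopic_paths_trans)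
qed

text \<open>To join two points of the box, first move off the punctures, then change the height, then
  move to the second shadow.\<close>
lemma path_connected_tower_box:
  assumes U: "open U" "connected U" and B: "convex B"
  shows "path_connected (tower \<inter> U \<times> B)"
proof -
  have join: "\<exists>g. path g \<and> path_image g \<subseteq> tower \<inter> U \<times> B \<and> pathstart g = (z, \<phi>) \<and> pathfinish g = (w, \<phi>)"
    if "(z, \<phi>) \<in> tower" "z \<in> U" "\<phi> \<in> B" "w \<in> U" "w \<notin> range p" for z w \<phi>
  proof -
    have "path_connected (U - (range p - {z}))"
      using U by (intro path_connected_open_diff_countable) auto
    moreover have "z \<in> U - (range p - {z})" "w \<in> U - (range p - {z})"
      using that by auto
    ultimately obtain g where g: "path g" "path_image g \<subseteq> U - (range p - {z})" "pathstart g = z" "pathfinish g = w"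
      unfolding path_connected_def by blast
    have "path (\<lambda>t. (g t, \<phi>))"
      using g unfolding path_def by (intro continuous_intros)
    moreover have "path_image (\<lambda>t. (g t, \<phi>)) \<subseteq> tower \<inter> U \<times> B"
    proof -
      have "g t \<in> U \<and> (g t \<in> range p \<longrightarrow> g t = z)" if "t \<in> {0..1}" for t
        using g(2) that by (auto simp: path_image_def image_subset_iff)
      then have "g t \<in> U" "p n = g t \<Longrightarrow> p n = z" if "t \<in> {0..1}" for t n
        using that by (metis, metis rangeI)
      then show ?thesis
        using that unfolding path_image_def mem_tower by (auto simp: mem_tower)
    qed
    ultimately show ?thesis
      using g by (intro exI[of _ "\<lambda>t. (g t, \<phi>)"]) (auto simp: pathstart_def pathfinish_def)
  qed
  have "path_component (tower \<inter> U \<times> B) (z, \<phi>) (z', \<psi>)"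
    if 1: "(z, \<phi>) \<in> tower" "z \<in> U" "\<phi> \<in> B" and 2: "(z', \<psi>) \<in> tower" "z' \<in> U" "\<psi> \<in> B" for z \<phi> z' \<psi>
  proof -
    have "uncountable U"
      using U 1 by (metis openE uncountable_ball countable_subset)
    then obtain w where w: "w \<in> U" "w \<notin> range p"
      using countable_subset[of U "range p"] by auto
    have "path_component (tower \<inter> U \<times> B) (z, \<phi>) (w, \<phi>)"
      using join[OF 1 w] unfolding path_component_def by blast
    moreover have "path_component (tower \<inter> U \<times> B) (z', \<psi>) (w, \<psi>)"
      using join[OF 2 w] unfolding path_component_def by blast
    moreover have "path_component (tower \<inter> U \<times> B) (w, \<phi>) (w, \<psi>)"
    proof (rule path_component_linepath)
      have "closed_segment (w, \<phi>) (w, \<psi>) \<subseteq> tower"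
        using 1 2 w by (intro segment_in_tower) (auto simp: mem_tower)
      moreover have "closed_segment (w, \<phi>) (w, \<psi>) \<subseteq> {w} \<times> B"
        using 1 2 B by (intro closed_segment_subset convex_Times) auto
      ultimately show "closed_segment (w, \<phi>) (w, \<psi>) \<subseteq> tower \<inter> U \<times> B"
        using w by blast
    qed
    ultimately show ?thesis
      by (meson path_component_sym path_component_trans)
  qed
  then show ?thesis
    unfolding path_connected_component by auto
qed

lemma path_connected_tower: "path_connected tower"
  using path_connected_tower_box[OF open_UNIV connected_UNIV convex_UNIV] by simp

lemma locally_path_connected_tower: "locally_path_connected_space (top_of_set tower)"
  unfolding locally_path_connected_space_def neighbourhood_base_of
proof (intro allI impI, elim conjE)
  fix V x
  assume V: "openin (top_of_set tower) V" and x: "x \<in> V"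
  obtain T where T: "open T" "V = tower \<inter> T"
    using V openin_open by blast
  obtain z \<phi> where z: "x = (z, \<phi>)"
    by fastforce
  obtain M N where MN: "open M" "open N" "z \<in> M" "\<phi> \<in> N" "M \<times> N \<subseteq> T"
    using T x z by (auto elim!: open_prod_elim)
  obtain d e where de: "d > 0" "ball z d \<subseteq> M" "e > 0" "ball \<phi> e \<subseteq> N"
    using MN by (meson openE)
  let ?U = "tower \<inter> ball z d \<times> ball \<phi> e"
  have "openin (top_of_set tower) ?U"
    by (intro openin_open_Int open_Times) auto
  moreover have "path_connectedin (top_of_set tower) ?U"
    using path_connected_tower_box[of "ball z d" "ball \<phi> e"] by (simp add: path_connectedin_subtopology)
  moreover have "x \<in> ?U" "?U \<subseteq> V"
    using x z T MN de by auto
  ultimately show "\<exists>U W. openin (top_of_set tower) U \<and> path_connectedin (top_of_set tower) W \<and> x \<in> U \<and> U \<subseteq> W \<and> W \<subseteq> V"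
    by blast
qed

end

section \<open>Homotopies on the whiskered Hawaiian earring\<close>

lemma homotopic_paths_conjugate_cancel:
  fixes S :: "'a::real_normed_vector set"
  assumes hom: "homotopic_paths S ((i +++ l) +++ reversepath i) ((i' +++ l') +++ reversepath i')"
    and p: "path i" "path l" "path l'" and eq: "\<And>t. t \<in> {0..1} \<Longrightarrow> i' t = i t"
    and loops: "pathstart l = pathfinish i" "pathfinish l = pathfinish i"
      "pathstart l' = pathfinish i" "pathfinish l' = pathfinish i"
  shows "homotopic_paths S l l'"
proof -
  have i': "path i'" "pathstart i' = pathstart i" "pathfinish i' = pathfinish i"
    using continuous_on_eq[of "{0..1}" i i'] p(1) eq by (auto simp: path_def pathstart_def pathfinish_def)
  have sub: "path_image i \<subseteq> S" "path_image l \<subseteq> S" "path_image l' \<subseteq> S"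
    using homotopic_paths_imp_subset[OF hom] loops i' by (auto simp: path_image_join)
  have cancel: "homotopic_paths S ((reversepath i +++ ((i +++ m) +++ reversepath i)) +++ i) m"
    if m: "path m" "path_image m \<subseteq> S" "pathstart m = pathfinish i" "pathfinish m = pathfinish i" for m
  proof -
    let ?r = "reversepath i" and ?c = "linepath (pathfinish i) (pathfinish i)"
    note facts = m p(1) sub(1) subset_path_image_join
    have rc: "homotopic_paths S (?r +++ i) ?c"
      using homotopic_paths_linv[OF p(1) sub(1)] .
    have "homotopic_paths S (?r +++ (i +++ m)) ((?r +++ i) +++ m)"
      using facts by (intro homotopic_paths_assoc) auto
    also have "homotopic_paths S \<dots> (?c +++ m)"
      using rc facts by (intro homotopic_paths_join) auto
    also have "homotopic_paths S \<dots> m"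
      using homotopic_paths_lid[OF m(1,2)] m(3) by simp
    finally have 1: "homotopic_paths S (?r +++ (i +++ m)) m" .
    have "homotopic_paths S (?r +++ ((i +++ m) +++ ?r)) ((?r +++ (i +++ m)) +++ ?r)"
      using facts by (intro homotopic_paths_assoc) (simp_all add: subset_path_image_join)
    also have "homotopic_paths S \<dots> (m +++ ?r)"
      using 1 facts by (intro homotopic_paths_join) auto
    finally have 2: "homotopic_paths S (?r +++ ((i +++ m) +++ ?r)) (m +++ ?r)" .
    have "homotopic_paths S ((?r +++ ((i +++ m) +++ ?r)) +++ i) ((m +++ ?r) +++ i)"
      using facts by (intro homotopic_paths_join[OF 2]) auto
    also have "homotopic_paths S \<dots> (m +++ (?r +++ i))"
      using facts by (subst homotopic_paths_sym_eq, intro homotopic_paths_assoc) auto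
    also have "homotopic_paths S \<dots> (m +++ ?c)"
      using rc facts by (intro homotopic_paths_join) auto
    also have "homotopic_paths S \<dots> m"
      using homotopic_paths_rid[OF m(1,2)] m(4) by simp
    finally show ?thesis .
  qed
  have ii: "homotopic_paths S i' i"
    using homotopic_paths_eq[OF p(1) sub(1), of i'] eq homotopic_paths_sym by metis
  have "homotopic_paths S ((i' +++ l') +++ reversepath i') ((i +++ l') +++ reversepath i)"
    using ii p sub loops i' by (intro homotopic_paths_join) (auto simp: homotopic_paths_reversepath)
  then have hom2: "homotopic_paths S ((i +++ l) +++ reversepath i) ((i +++ l') +++ reversepath i)"
    using hom homotopic_paths_trans by blast
  have "homotopic_paths S (reversepath i +++ ((i +++ l) +++ reversepath i))
      (reversepath i +++ ((i +++ l') +++ reversepath i))"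
    using p(1) sub(1) loops by (intro homotopic_paths_join[OF _ hom2]) auto
  then have "homotopic_paths S ((reversepath i +++ ((i +++ l) +++ reversepath i)) +++ i)
      ((reversepath i +++ ((i +++ l') +++ reversepath i)) +++ i)"
    by (rule homotopic_paths_join) (use p(1) sub(1) in auto)
  then show ?thesis
    using cancel[of l] cancel[of l'] p sub loops by (meson homotopic_paths_sym homotopic_paths_trans)
qed

definition unit_fractions :: "real set" where
  "unit_fractions = insert 0 ((\<lambda>n. 1 / real n) ` {1..})"

lemma compact_unit_fractions: "compact unit_fractions"
proof -
  have "(\<lambda>n. 1 / real (Suc n)) \<longlonglongrightarrow> 0"
    using LIMSEQ_inverse_real_of_nat by (simp add: inverse_eq_divide)
  then have "compact (insert 0 (range (\<lambda>n. 1 / real (Suc n))))"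
    by (rule compact_sequence_with_limit)
  moreover have "{1..} = range Suc"
    by (auto simp: image_iff) (metis Suc_le_D Suc_eq_plus1)
  ultimately show ?thesis
    by (simp add: unit_fractions_def image_image)
qed

lemma unit_fraction_gap:
  assumes "m \<ge> 1" "n \<ge> 1" "\<bar>1 / real m - 1 / real n\<bar> < 1 / real n - 1 / real (Suc n)"
  shows "m = n"
proof (rule ccontr)
  assume "m \<noteq> n"
  then consider "Suc n \<le> m" | "Suc m \<le> n"
    by linarith
  then show False
  proof cases
    case 1
    then have "1 / real m \<le> 1 / real (Suc n)"
      by (intro divide_left_mono) auto
    with assms(3) show False
      by linarith
  next
    case 2
    then have "1 / real n \<le> 1 / real (Suc m)"
      by (intro divide_left_mono) auto
    moreover have "1 / real m - 1 / real (Suc m) = 1 / (real m * real (Suc m))"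
      "1 / real n - 1 / real (Suc n) = 1 / (real n * real (Suc n))"
      using assms(1,2) by (auto simp: field_simps)
    moreover have "1 / (real n * real (Suc n)) \<le> 1 / (real m * real (Suc m))"
      using 2 assms(1,2) by (intro divide_left_mono mult_mono) auto
    ultimately show False
      using assms(3) by linarith
  qed
qed

lemma continuous_on_null_sequence:
  fixes H :: "nat \<Rightarrow> 'a::metric_space \<Rightarrow> 'b::metric_space"
  assumes cont: "\<And>n. n \<ge> 1 \<Longrightarrow> continuous_on S (H n)"
    and bound: "\<And>n x. \<lbrakk>n \<ge> 1; x \<in> S\<rbrakk> \<Longrightarrow> dist (H n x) z \<le> \<rho> n" and \<rho>: "\<rho> \<longlonglongrightarrow> 0"
  shows "continuous_on (S \<times> unit_fractions) (\<lambda>(x, r). if r = 0 then z else H (nat \<lfloor>1 / r\<rfloor>) x)"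
    (is "continuous_on _ ?k")
proof -
  have k: "?k (x, 1 / real n) = H n x" if "n \<ge> 1" for x n
    using that by simp
  have "\<exists>d>0. \<forall>y\<in>S \<times> unit_fractions. dist y w < d \<longrightarrow> dist (?k y) (?k w) < e"
    if "w \<in> S \<times> unit_fractions" "e > 0" for w e
  proof -
    obtain x r where w: "w = (x, r)" "x \<in> S" "r \<in> unit_fractions"
      using \<open>w \<in> _\<close> by blast
    show ?thesis
    proof (cases "r = 0")
      case True
      obtain N where N: "\<And>n. n \<ge> N \<Longrightarrow> \<rho> n < e"
        using order_tendstoD(2)[OF \<rho> \<open>e > 0\<close>] by (auto simp: eventually_sequentially)
      have "dist (?k y) (?k w) < e" if y: "y \<in> S \<times> unit_fractions" "dist y w < 1 / real (Suc N)" for y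
      proof -
        obtain x' r' where y': "y = (x', r')" "x' \<in> S" "r' \<in> unit_fractions"
          using y(1) by blast
        show ?thesis
        proof (cases "r' = 0")
          case False
          then obtain n where n: "n \<ge> 1" "r' = 1 / real n"
            using y'(3) by (auto simp: unit_fractions_def)
          have "\<bar>r'\<bar> < 1 / real (Suc N)"
            using y(2) dist_snd_le[of y w] by (simp add: y' w True dist_real_def)
          then have "real (Suc N) < real n"
            using n by (simp add: field_simps)
          then have "\<rho> n < e"
            by (intro N) auto
          then have "dist (H n x') z < e"
            using bound[OF n(1) y'(2)] by linarith
          then show ?thesis
            using k[OF n(1), of x'] by (simp add: y' w True n)
        qed (use \<open>e > 0\<close> in \<open>simp add: y' w True\<close>)
      qed
      then show ?thesis
        by (intro exI[of _ "1 / real (Suc N)"]) auto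
    next
      case False
      then obtain n where n: "n \<ge> 1" "r = 1 / real n"
        using w(3) by (auto simp: unit_fractions_def)
      obtain d where d: "d > 0" "\<And>x'. x' \<in> S \<Longrightarrow> dist x' x < d \<Longrightarrow> dist (H n x') (H n x) < e"
        using cont[OF n(1)] w(2) \<open>e > 0\<close> unfolding continuous_on_iff by metis
      define d' where "d' = min d (1 / real n - 1 / real (Suc n))"
      have "1 / real (Suc n) < 1 / real n"
        using n(1) by (intro divide_strict_left_mono) auto
      then have "d' > 0"
        using d by (simp add: d'_def)
      moreover have "dist (?k y) (?k w) < e" if y: "y \<in> S \<times> unit_fractions" "dist y w < d'" for y
      proof -
        obtain x' r' where y': "y = (x', r')" "x' \<in> S" "r' \<in> unit_fractions"
          using y(1) by blast
        have r': "\<bar>r' - 1 / real n\<bar> < 1 / real n - 1 / real (Suc n)" and x': "dist x' x < d"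
          using y(2) dist_snd_le[of y w] dist_fst_le[of y w] by (auto simp: y' w n dist_real_def d'_def)
        have "r' \<noteq> 0"
          using r' by auto
        then obtain m where m: "m \<ge> 1" "r' = 1 / real m"
          using y'(3) by (auto simp: unit_fractions_def)
        have "m = n"
          using unit_fraction_gap[OF m(1) n(1)] r' m by simp
        then show ?thesis
          using d(2)[OF y'(2) x'] k[OF n(1)] by (simp add: y' w n m)
      qed
      ultimately show ?thesis
        by blast
    qed
  qed
  then show ?thesis
    unfolding continuous_on_iff by blast
qed

text \<open>The earring is the quotient of \<open>[0,1] \<times> {0, \<dots>, 1/3, 1/2, 1}\<close> under this map.\<close>
definition earring_param :: "real \<times> real \<Rightarrow> real \<times> real" where
  "earring_param = (\<lambda>(t, r). (r * (1 - cos (2 * pi * t)), - r * sin (2 * pi * t)))"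

lemma earring_param_loop: "earring_param (t, 1 / real n) = hawaiian_loop n t"
  by (simp add: earring_param_def hawaiian_loop_def)

lemma earring_param_image: "earring_param ` ({0..1} \<times> unit_fractions) = hawaiian_earring"
proof (intro equalityI subsetI)
  fix x assume "x \<in> earring_param ` ({0..1} \<times> unit_fractions)"
  then obtain t r where x: "x = earring_param (t, r)" "r \<in> unit_fractions"
    by blast
  show "x \<in> hawaiian_earring"
  proof (cases "r = 0")
    case True
    then have "x = hawaiian_loop 1 0"
      by (simp add: x earring_param_def zero_prod_def)
    then show ?thesis
      using hawaiian_loop_in_earring[of 1 0] by simp
  next
    case False
    then obtain n where "n \<ge> 1" "r = 1 / real n"
      using x(2) by (auto simp: unit_fractions_def)
    then show ?thesis
      using hawaiian_loop_in_earring x(1) earring_param_loop by simp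
  qed
next
  fix x assume "x \<in> hawaiian_earring"
  then obtain n where n: "n \<ge> 1" "x \<in> sphere (1 / real n, 0) (1 / real n)"
    by (auto simp: hawaiian_earring_def)
  obtain a b where ab: "x = (a, b)"
    by fastforce
  have "sqrt ((1 / real n - a)\<^sup>2 + b\<^sup>2) = 1 / real n"
    using n(2) by (simp add: ab dist_Pair_Pair dist_real_def power2_abs)
  then have "(1 / real n - a)\<^sup>2 + b\<^sup>2 = (1 / real n)\<^sup>2"
    using real_sqrt_pow2[of "(1 / real n - a)\<^sup>2 + b\<^sup>2"] by simp
  then have "(1 - n * a)\<^sup>2 + (- n * b)\<^sup>2 = 1"
    using n(1) by (simp add: field_simps power2_eq_square)
  then obtain \<theta> where \<theta>: "0 \<le> \<theta>" "\<theta> < 2 * pi" "1 - n * a = cos \<theta>" "- n * b = sin \<theta>"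
    using sincos_total_2pi by metis
  then have "x = earring_param (\<theta> / (2 * pi), 1 / real n)"
    using n(1) by (simp add: ab earring_param_def field_simps)
  moreover have "\<theta> / (2 * pi) \<in> {0..1}"
    using \<theta> by (simp add: field_simps)
  moreover have "1 / real n \<in> unit_fractions"
    using n by (auto simp: unit_fractions_def)
  ultimately show "x \<in> earring_param ` ({0..1} \<times> unit_fractions)"
    by blast
qed

lemma cos_2pi_eq_1:
  assumes "t \<in> {0..1}" "cos (2 * pi * t) = 1"
  shows "t = 0 \<or> t = 1"
proof -
  obtain n :: int where "2 * pi * t = of_int n * (2 * pi)"
    using assms(2) cos_one_2pi_int by (auto simp: mult.commute)
  then have "t = of_int n"
    by simp
  then show ?thesis
    using assms(1) by auto
qed

lemma earring_param_eq:
  assumes eq: "earring_param (t, r) = earring_param (t', r')"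
    and t: "t \<in> {0..1}" "t' \<in> {0..1}" and r: "r \<ge> 0" "r' \<ge> 0"
  shows "(r = 0 \<or> t = 0 \<or> t = 1) \<and> (r' = 0 \<or> t' = 0 \<or> t' = 1) \<or> t = t' \<and> r = r'"
proof (cases "earring_param (t, r) = 0")
  case True
  then have "r * (1 - cos (2 * pi * t)) = 0" "r' * (1 - cos (2 * pi * t')) = 0"
    using eq by (auto simp: earring_param_def zero_prod_def)
  then show ?thesis
    using cos_2pi_eq_1 t by auto
next
  case False
  let ?x = "r * (1 - cos (2 * pi * t))" and ?y = "r * sin (2 * pi * t)"
  have xy: "?x = r' * (1 - cos (2 * pi * t'))" "?y = r' * sin (2 * pi * t')"
    using eq by (auto simp: earring_param_def)
  have sq: "(s * (1 - cos u))\<^sup>2 + (s * sin u)\<^sup>2 = 2 * s * (s * (1 - cos u))" for s u :: real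
  proof -
    have "(s * (1 - cos u))\<^sup>2 + (s * sin u)\<^sup>2 = s\<^sup>2 * (1 - 2 * cos u + ((sin u)\<^sup>2 + (cos u)\<^sup>2))"
      by algebra
    also have "\<dots> = 2 * s * (s * (1 - cos u))"
      unfolding sin_cos_squared_add by (simp add: algebra_simps power2_eq_square)
    finally show ?thesis .
  qed
  have "2 * r * ?x = 2 * r' * ?x"
    using sq[of r "2 * pi * t"] sq[of r' "2 * pi * t'"] unfolding xy by metis
  moreover have "?x \<noteq> 0"
  proof
    assume "?x = 0"
    then have "r = 0 \<or> t = 0 \<or> t = 1"
      using cos_2pi_eq_1 t by auto
    then show False
      using False by (auto simp: earring_param_def zero_prod_def)
  qed
  ultimately have rr: "r = r'" "r \<noteq> 0"
    by auto
  then have "cos (2 * pi * t) = cos (2 * pi * t')" "sin (2 * pi * t) = sin (2 * pi * t')"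
    using xy by auto
  then obtain n :: int where "2 * pi * t = 2 * pi * t' + 2 * pi * n"
    using sin_cos_eq_iff by blast
  then have "2 * pi * t = 2 * pi * (t' + n)"
    by (simp add: algebra_simps)
  then have "t = t' + n"
    by simp
  then show ?thesis
    using t rr by auto
qed

lemma whiskered_homotopy:
  fixes u v :: "real \<times> real \<Rightarrow> 'b::metric_space" and H :: "nat \<Rightarrow> real \<times> real \<Rightarrow> 'b"
  assumes u: "continuous_on whiskered_set u" and v: "continuous_on whiskered_set v"
    and uv: "\<And>x. x \<in> {-1..0} \<times> {0} \<Longrightarrow> u x = v x" and uT: "u ` ({-1..0} \<times> {0}) \<subseteq> T"
    and H: "\<And>n. n \<ge> 1 \<Longrightarrow> continuous_on ({0..1} \<times> {0..1}) (H n)"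
      "\<And>n x. \<lbrakk>n \<ge> 1; x \<in> {0..1} \<times> {0..1}\<rbrakk> \<Longrightarrow> H n x \<in> T"
      "\<And>n t. \<lbrakk>n \<ge> 1; t \<in> {0..1}\<rbrakk> \<Longrightarrow> H n (0, t) = u (hawaiian_loop n t)"
      "\<And>n t. \<lbrakk>n \<ge> 1; t \<in> {0..1}\<rbrakk> \<Longrightarrow> H n (1, t) = v (hawaiian_loop n t)"
      "\<And>n s t. \<lbrakk>n \<ge> 1; s \<in> {0..1}; t \<in> {0, 1}\<rbrakk> \<Longrightarrow> H n (s, t) = u 0"
      "\<And>n x. \<lbrakk>n \<ge> 1; x \<in> {0..1} \<times> {0..1}\<rbrakk> \<Longrightarrow> dist (H n x) (u 0) \<le> \<rho> n"
    and \<rho>: "\<rho> \<longlonglongrightarrow> 0"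
    and q: "path q" "path_image q \<subseteq> whiskered_set" "q 0 = whisker_base" "q 1 = whisker_base"
  shows "homotopic_paths T (u \<circ> q) (v \<circ> q)"
proof -
  have zero: "(0::real \<times> real) \<in> {-1..0} \<times> {0}"
    by (simp add: zero_prod_def)
  have whisker0: "u 0 = v 0" "u 0 \<in> T"
    using uv[OF zero] uT[THEN subsetD, OF imageI[OF zero]] by simp_all
  let ?S = "{0..1::real} \<times> {0..1::real}"
  let ?D = "{0..1::real} \<times> ({0..1::real} \<times> unit_fractions)" and ?F = "\<lambda>(s::real, y). (s, earring_param y)"
  define k where "k = (\<lambda>(x :: real \<times> real, r :: real). if r = 0 then u 0 else H (nat \<lfloor>1 / r\<rfloor>) x)"
  have k: "k (x, 1 / real n) = H n x" "k (x, 0) = u 0" if "n \<ge> 1" for x n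
    using that by (simp_all add: k_def)
  have k_cont: "continuous_on (?S \<times> unit_fractions) k"
    unfolding k_def by (rule continuous_on_null_sequence[OF H(1) H(6) \<rho>])
  let ?k = "\<lambda>(s, t, r). k ((s, t), r)"
  have "continuous_on ?D (k \<circ> (\<lambda>(s, t, r). ((s, t), r)))"
    by (intro continuous_on_compose continuous_on_subset[OF k_cont])
      (auto simp: case_prod_unfold intro!: continuous_intros)
  then have cont_k: "continuous_on ?D ?k"
    by (simp add: o_def case_prod_unfold)
  have F: "continuous_on ?D ?F"
    unfolding earring_param_def case_prod_unfold by (intro continuous_intros)
  have F_image: "?F ` ?D = {0..1} \<times> hawaiian_earring"
    by (force simp: earring_param_image[symmetric])
  have D: "compact ?D"
    by (intro compact_Times compact_unit_fractions) auto
  have "quotient_map (top_of_set ?D) (top_of_set ({0..1} \<times> hawaiian_earring)) ?F"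
  proof (rule continuous_imp_quotient_map)
    show "continuous_map (top_of_set ?D) (top_of_set ({0..1} \<times> hawaiian_earring)) ?F"
      using F equalityD1[OF F_image] unfolding continuous_map_subtopology_eu image_subset_iff_funcset by blast
    show "?F ` topspace (top_of_set ?D) = topspace (top_of_set ({0..1::real} \<times> hawaiian_earring))"
      unfolding topspace_euclidean_subtopology by (rule F_image)
  qed (use D in \<open>auto simp: compact_space_subtopology Hausdorff_space_subtopology\<close>)
  moreover have "?k y = ?k y'" if y: "y \<in> ?D" "y' \<in> ?D" "?F y = ?F y'" for y y'
  proof -
    obtain s t r s' t' r' where *: "y = (s, t, r)" "y' = (s', t', r')"
      by (metis prod_cases3)
    have r: "r \<ge> 0" "r' \<ge> 0"
      using y by (auto simp: * unit_fractions_def)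
    have const: "k ((s, t), r) = u 0" if c: "r = 0 \<or> t = 0 \<or> t = 1" "s \<in> {0..1}" "r \<in> unit_fractions" for s t r
    proof (cases "r = 0")
      case False
      then obtain n where "n \<ge> 1" "r = 1 / real n"
        using c(3) by (auto simp: unit_fractions_def)
      then show ?thesis
        using c False k H(5)[of n s t] by simp
    qed (simp add: k_def)
    have "earring_param (t, r) = earring_param (t', r')"
      using y by (simp add: *)
    from earring_param_eq[OF this _ _ r] show ?thesis
      using y const[of r t s] const[of r' t' s'] by (auto simp: *)
  qed
  ultimately obtain g where g: "continuous_map (top_of_set ({0..1} \<times> hawaiian_earring)) euclidean g"
      "\<And>y. y \<in> ?D \<Longrightarrow> g (?F y) = ?k y"
    using quotient_map_lift_exists[of "top_of_set ?D" "top_of_set ({0..1} \<times> hawaiian_earring)" ?F euclidean ?k] cont_k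
    unfolding topspace_euclidean_subtopology continuous_map_iff_continuous by metis
  have k_range: "?k y \<in> T" if y: "y \<in> ?D" for y
  proof -
    obtain s t r where *: "y = (s, t, r)" "s \<in> {0..1}" "t \<in> {0..1}" "r \<in> unit_fractions"
      using y by auto
    show ?thesis
    proof (cases "r = 0")
      case False
      then obtain n where "n \<ge> 1" "r = 1 / real n"
        using *(4) by (auto simp: unit_fractions_def)
      then show ?thesis
        using * k H(2)[of n "(s, t)"] by simp
    qed (use whisker0 in \<open>simp add: * k_def\<close>)
  qed
  have g_param: "g (s, earring_param (t, r)) = k ((s, t), r)" if "(s, t, r) \<in> ?D" for s t r
    using g(2)[OF that] by simp
  define w where "w = (\<lambda>(s::real, x). if x \<in> hawaiian_earring then g (s, x) else u x)"
  have earring_fst: "fst x \<ge> 0" "fst x = 0 \<Longrightarrow> x = 0" if x: "x \<in> hawaiian_earring" for x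
  proof -
    obtain t r where tr: "x = earring_param (t, r)" "t \<in> {0..1}" "r \<in> unit_fractions"
      using x unfolding earring_param_image[symmetric] by blast
    have r: "r \<ge> 0"
      using tr by (auto simp: unit_fractions_def)
    then show "fst x \<ge> 0"
      by (simp add: tr earring_param_def)
    show "x = 0" if "fst x = 0"
      using that cos_2pi_eq_1[OF tr(2)] by (auto simp: tr(1) earring_param_def zero_prod_def)
  qed
  have zero_in: "0 \<in> hawaiian_earring"
    using hawaiian_loop_in_earring[of 1 0] by simp
  have g0: "g (s, 0) = u 0" if "s \<in> {0..1}" for s
    using g_param[of s 0 0] that by (simp add: earring_param_def zero_prod_def unit_fractions_def k_def)
  have w_whisker: "w (s, x) = u x" if "x \<in> {-1..0} \<times> {0}" "s \<in> {0..1}" for s x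
  proof (cases "x \<in> hawaiian_earring")
    case True
    then have "x = 0"
      using earring_fst that(1) by (metis antisym_conv atLeastAtMost_iff mem_Times_iff)
    then show ?thesis
      using g0 that zero_in by (simp add: w_def)
  qed (simp add: w_def)
  have w_earring: "w (s, x) = g (s, x)" if "x \<in> hawaiian_earring" for s x
    using that by (simp add: w_def)
  have "continuous_on (({0..1} \<times> hawaiian_earring) \<union> ({0..1} \<times> ({-1..0} \<times> {0}))) w"
  proof (rule continuous_on_Un_local)
    have "compact (({0..1::real} \<times> hawaiian_earring))"
      using compact_continuous_image[OF F D] unfolding F_image .
    then show "closedin (top_of_set (({0..1} \<times> hawaiian_earring) \<union> ({0..1} \<times> ({-1..0} \<times> {0})))) ({0..1::real} \<times> hawaiian_earring)"
      by (intro closed_subset compact_imp_closed) auto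
    show "closedin (top_of_set (({0..1} \<times> hawaiian_earring) \<union> ({0..1} \<times> ({-1..0} \<times> {0})))) ({0..1::real} \<times> ({-1..0} \<times> {0}))"
      by (intro closed_subset closed_Times) auto
    show "continuous_on ({0..1} \<times> hawaiian_earring) w"
      using g(1) by (rule_tac continuous_on_eq[of _ g]) (auto simp: w_earring)
    have "continuous_on ({0..1::real} \<times> ({-1..0} \<times> {0})) (u \<circ> snd)"
      by (intro continuous_on_compose continuous_intros continuous_on_subset[OF u]) auto
    then show "continuous_on ({0..1} \<times> ({-1..0} \<times> {0})) w"
      by (rule continuous_on_eq) (auto simp: w_whisker)
  qed
  then have w_cont: "continuous_on ({0..1} \<times> whiskered_set) w"
    by (simp add: Sigma_Un_distrib2)
  have w_range: "w (s, x) \<in> T" if s: "s \<in> {0..1}" and x: "x \<in> whiskered_set" for s x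
  proof (cases "x \<in> hawaiian_earring")
    case True
    then have "(s, x) \<in> ?F ` ?D"
      using s F_image by simp
    then obtain y where "y \<in> ?D" "(s, x) = ?F y"
      by blast
    then show ?thesis
      using g(2) k_range True by (metis w_earring)
  next
    case False
    then show ?thesis
      using x s uT w_whisker by auto
  qed
  have w01: "w (0, x) = u x" "w (1, x) = v x" if x: "x \<in> whiskered_set" for x
  proof -
    have "w (0, x) = u x \<and> w (1, x) = v x"
    proof (cases "x \<in> hawaiian_earring")
      case True
      then obtain t r where tr: "x = earring_param (t, r)" "t \<in> {0..1}" "r \<in> unit_fractions"
        unfolding earring_param_image[symmetric] by blast
      have g': "w (0, x) = k ((0, t), r)" "w (1, x) = k ((1, t), r)"
        using g_param tr True by (auto simp: w_earring)
      show ?thesis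
      proof (cases "r = 0")
        case True
        then have "x = 0"
          by (simp add: tr earring_param_def zero_prod_def)
        then show ?thesis
          using g' whisker0 True by (simp add: k_def)
      next
        case False
        then obtain n where n: "n \<ge> 1" "r = 1 / real n"
          using tr(3) by (auto simp: unit_fractions_def)
        then show ?thesis
          using g' k H(3,4)[OF n(1) tr(2)] tr(1) earring_param_loop by simp
      qed
    next
      case False
      then show ?thesis
        using x w_whisker uv by auto
    qed
    then show "w (0, x) = u x" "w (1, x) = v x"
      by auto
  qed
  have q_in: "q t \<in> whiskered_set" if "t \<in> {0..1}" for t
    using q(2) that unfolding path_image_def by blast
  show ?thesis
    unfolding homotopic_paths
  proof (intro exI[of _ "\<lambda>(s, t). w (s, q t)"] conjI ballI)
    have "continuous_on ({0..1::real} \<times> {0..1}) (\<lambda>y. q (snd y))"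
      by (rule continuous_on_compose2[OF q(1)[unfolded path_def]]) (auto intro: continuous_on_snd)
    then have "continuous_on ({0..1::real} \<times> {0..1}) (\<lambda>y. (fst y, q (snd y)))"
      by (intro continuous_on_Pair continuous_on_fst continuous_on_id)
    then have "continuous_on ({0..1} \<times> {0..1}) (w \<circ> (\<lambda>y. (fst y, q (snd y))))"
    proof (rule continuous_on_compose)
      have "(\<lambda>y. (fst y, q (snd y))) ` ({0..1} \<times> {0..1}) \<subseteq> {0..1::real} \<times> whiskered_set"
        by (intro image_subsetI) (simp add: q_in mem_Times_iff del: Un_iff)
      then show "continuous_on ((\<lambda>y. (fst y, q (snd y))) ` ({0..1} \<times> {0..1})) w"
        by (rule continuous_on_subset[OF w_cont])
    qed
    then show "continuous_on ({0..1} \<times> {0..1}) (\<lambda>(s, t). w (s, q t))"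
      by (simp add: o_def case_prod_unfold)
    have base: "whisker_base \<in> {-1..0} \<times> {0}"
      by (simp add: whisker_base_def)
    show "pathstart ((\<lambda>(s, t). w (s, q t)) \<circ> Pair s) = pathstart (u \<circ> q)"
      "pathfinish ((\<lambda>(s, t). w (s, q t)) \<circ> Pair s) = pathfinish (u \<circ> q)" if "s \<in> {0..1}" for s
      using that w_whisker[OF base] q(3,4) by (simp_all add: pathstart_def pathfinish_def)
    show "(\<lambda>(s, t). w (s, q t)) \<in> {0..1} \<times> {0..1} \<rightarrow> T"
      using w_range q_in by (simp add: Pi_iff)
    show "(case (0, t) of (s, t) \<Rightarrow> w (s, q t)) = (u \<circ> q) t"
      "(case (1, t) of (s, t) \<Rightarrow> w (s, q t)) = (v \<circ> q) t" if "t \<in> {0..1}" for t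
      using w01[OF q_in[OF that]] by simp_all
  qed
qed

section \<open>Transfinite products in the tower\<close>

definition clip :: "real \<Rightarrow> real \<Rightarrow> real" where
  "clip r x = max (- r) (min r x)"

definition square_retract :: "complex \<Rightarrow> real \<Rightarrow> complex \<Rightarrow> complex" where
  "square_retract z r w = z + Complex (clip r (Re (w - z))) (clip r (Im (w - z)))"

lemma continuous_on_square_retract: "continuous_on S (square_retract z r)"
  unfolding square_retract_def clip_def Complex_eq by (intro continuous_intros)

lemma square_retract_id: "dist w z \<le> r \<Longrightarrow> square_retract z r w = w"
  using abs_Re_le_cmod[of "w - z"] abs_Im_le_cmod[of "w - z"]
  by (auto simp: square_retract_def clip_def dist_norm complex_eq_iff)

lemma dist_square_retract_le:
  assumes "r \<ge> 0"
  shows "dist (square_retract z r w) z \<le> 2 * r"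
proof -
  have "dist (square_retract z r w) z \<le> \<bar>clip r (Re (w - z))\<bar> + \<bar>clip r (Im (w - z))\<bar>"
    unfolding square_retract_def dist_norm using cmod_le by (metis add_diff_cancel_left' complex.sel)
  moreover have "\<bar>clip r x\<bar> \<le> r" for x
    using assms by (auto simp: clip_def)
  ultimately show ?thesis
    by (smt (verit))
qed

lemma square_retract_eqD:
  assumes "square_retract z r w = y" "\<bar>Re (y - z)\<bar> \<noteq> r" "\<bar>Im (y - z)\<bar> \<noteq> r" "r \<ge> 0"
  shows "w = y"
proof -
  have "Re (y - z) = clip r (Re (w - z))" "Im (y - z) = clip r (Im (w - z))"
    using assms(1) by (auto simp: square_retract_def)
  moreover have clip: "clip r x = x" if "\<bar>clip r x\<bar> \<noteq> r" for x
    using that assms(4) by (auto simp: clip_def max_def min_def split: if_splits)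
  ultimately have "Re (y - z) = Re (w - z)" "Im (y - z) = Im (w - z)"
    using assms(2,3) by metis+
  then show ?thesis
    by (simp add: complex_eq_iff)
qed

text \<open>Null homotopies can be made small: for all but countably many \<open>r\<close> the boundary of the
  square of radius \<open>r\<close> misses the punctures, so the retraction onto it avoids them as well.\<close>
lemma generic_radii:
  fixes p :: "nat \<Rightarrow> complex"
  assumes "m \<longlonglongrightarrow> 0" "\<And>n. m n \<ge> 0"
  obtains r where "r \<longlonglongrightarrow> 0" "\<And>n. m n < r n"
    "\<And>n i. \<bar>Re (p i - z)\<bar> \<noteq> r n" "\<And>n i. \<bar>Im (p i - z)\<bar> \<noteq> r n"
proof -
  let ?B = "range (\<lambda>i. \<bar>Re (p i - z)\<bar>) \<union> range (\<lambda>i. \<bar>Im (p i - z)\<bar>)"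
  have "\<exists>x\<in>{m n<..<m n + inverse (real (Suc n))}. x \<notin> ?B" for n
  proof (rule open_minus_countable)
    show "{m n<..<m n + inverse (real (Suc n))} \<noteq> {}"
      using positive_imp_inverse_positive[of "real (Suc n)"] by (subst greaterThanLessThan_empty_iff) linarith
  qed auto
  then have "\<forall>n. \<exists>x. x \<in> {m n<..<m n + inverse (real (Suc n))} \<and> x \<notin> ?B"
    by blast
  from choice[OF this]
  obtain r where r: "\<And>n. r n \<in> {m n<..<m n + inverse (real (Suc n))}" "\<And>n. r n \<notin> ?B"
    by blast
  have "(\<lambda>n. m n + inverse (real (Suc n))) \<longlonglongrightarrow> 0 + 0"
    by (intro tendsto_add assms LIMSEQ_inverse_real_of_nat)
  then have lim: "(\<lambda>n. m n + inverse (real (Suc n))) \<longlonglongrightarrow> 0"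
    by simp
  have "r \<longlonglongrightarrow> 0"
  proof (rule tendsto_sandwich[OF _ _ assms(1) lim])
    show "\<forall>\<^sub>F n in sequentially. m n \<le> r n" "\<forall>\<^sub>F n in sequentially. r n \<le> m n + inverse (real (Suc n))"
      using r(1) by (auto intro!: always_eventually less_imp_le)
  qed
  moreover have "m n < r n" for n
    using r(1)[of n] by simp
  moreover have "\<bar>Re (p i - z)\<bar> \<noteq> r n" for n i
  proof
    assume eq: "\<bar>Re (p i - z)\<bar> = r n"
    have "\<bar>Re (p i - z)\<bar> \<in> ?B"
      by blast
    then show False
      using r(2)[of n] unfolding eq by contradiction
  qed
  moreover have "\<bar>Im (p i - z)\<bar> \<noteq> r n" for n i
  proof
    assume eq: "\<bar>Im (p i - z)\<bar> = r n"
    have "\<bar>Im (p i - z)\<bar> \<in> ?B"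
      by blast
    then show False
      using r(2)[of n] unfolding eq by contradiction
  qed
  ultimately show thesis
    using that by blast
qed

lemma loops_shrink:
  fixes u :: "real \<times> real \<Rightarrow> 'b::metric_space"
  assumes u: "continuous_on whiskered_set u"
  obtains m where "m \<longlonglongrightarrow> 0" "\<And>n. m n \<ge> 0"
    "\<And>n t. \<lbrakk>n \<ge> 1; t \<in> {0..1}\<rbrakk> \<Longrightarrow> dist (u (hawaiian_loop n t)) (u 0) \<le> m n"
proof -
  let ?d = "\<lambda>n t. dist (u (hawaiian_loop n t)) (u 0)"
  define m where "m n = (if n = 0 then 0 else Sup (?d n ` {0..1}))" for n
  have "bounded (?d n ` {0..1})" if "n \<ge> 1" for n
  proof -
    have "continuous_on {0..1} (u \<circ> hawaiian_loop n)"
      using path_hawaiian_loop[of n] hawaiian_loop_in_earring[OF that] unfolding path_def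
      by (intro continuous_on_compose continuous_on_subset[OF u]) auto
    then have "continuous_on {0..1} (?d n)"
      unfolding o_def by (intro continuous_intros)
    then show ?thesis
      by (intro compact_imp_bounded compact_continuous_image) auto
  qed
  then have le: "?d n t \<le> m n" if "n \<ge> 1" "t \<in> {0..1}" for n t
    using that unfolding m_def by (auto intro!: cSup_upper bounded_imp_bdd_above)
  have nonneg: "m n \<ge> 0" for n
    using le[of n 0] by (cases "n = 0") (auto simp: m_def)
  have "m \<longlonglongrightarrow> 0"
  proof (rule tendstoI)
    fix e :: real assume "e > 0"
    have "0 \<in> whiskered_set"
      by (auto simp: zero_prod_def)
    then obtain d where d: "d > 0" "\<And>x. x \<in> whiskered_set \<Longrightarrow> dist x 0 < d \<Longrightarrow> dist (u x) (u 0) < e / 2"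
      using u \<open>e > 0\<close> unfolding continuous_on_iff by (meson half_gt_zero)
    obtain N :: nat where N: "2 / d < N"
      using reals_Archimedean2 by blast
    have "dist (m n) 0 < e" if n: "n \<ge> Suc N" for n
    proof -
      have "?d n t \<le> e / 2" if "t \<in> {0..1}" for t
      proof -
        have n1: "n \<ge> 1"
          using n by simp
        have "dist (hawaiian_loop n t) 0 \<le> dist (hawaiian_loop n t) (1 / real n, 0) + dist (1 / real n, 0) (0 :: real \<times> real)"
          by (rule dist_triangle)
        also have "\<dots> = 2 / real n"
          using hawaiian_loop_in_sphere[OF n1, of t] by (simp add: dist_commute zero_prod_def dist_Pair_Pair)
        also have "\<dots> < d"
        proof -
          have "2 / d < real n"
            using N n by linarith
          then show ?thesis
            using d n1 by (simp add: field_simps)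
        qed
        finally show ?thesis
          using d(2)[of "hawaiian_loop n t"] hawaiian_loop_in_earring[OF n1] by fastforce
      qed
      then have "Sup (?d n ` {0..1}) \<le> e / 2"
        by (intro cSUP_least) auto
      then have "m n \<le> e / 2"
        using \<open>e > 0\<close> by (simp add: m_def)
      then show ?thesis
        using nonneg[of n] \<open>e > 0\<close> by simp
    qed
    then show "\<forall>\<^sub>F n in sequentially. dist (m n) 0 < e"
      by (rule eventually_sequentiallyI)
  qed
  then show thesis
    using that le nonneg by blast
qed

lemma compact_whiskered_set: "compact whiskered_set"
proof -
  have "compact (earring_param ` ({0..1} \<times> unit_fractions))"
    unfolding earring_param_def case_prod_unfold
    by (intro compact_continuous_image compact_Times compact_unit_fractions continuous_intros) auto
  then show ?thesis
    unfolding earring_param_image by (intro compact_Un compact_Times) auto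
qed

context puncture_ideal
begin

lemma tower_pi1:
  assumes a: "continuous_on whiskered_set a" "a ` whiskered_set \<subseteq> tower"
    and b: "continuous_on whiskered_set b" "b ` whiskered_set \<subseteq> tower"
    and ab: "\<And>x. x \<in> {-1..0} \<times> {0} \<Longrightarrow> a x = b x"
    and loops: "\<And>n. n \<ge> 1 \<Longrightarrow> homotopic_paths tower (a \<circ> whisker_loop n) (b \<circ> whisker_loop n)"
    and q: "path q" "path_image q \<subseteq> whiskered_set" "q 0 = whisker_base" "q 1 = whisker_base"
  shows "homotopic_paths tower (a \<circ> q) (b \<circ> q)"
proof -
  define u where "u = fst \<circ> a"
  define v where "v = fst \<circ> b"
  have u: "continuous_on whiskered_set u" and v: "continuous_on whiskered_set v"
    unfolding u_def v_def using a b by (auto intro!: continuous_on_compose continuous_intros)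
  have zero_in: "(0::real \<times> real) \<in> {-1..0} \<times> {0}"
    by (simp add: zero_prod_def)
  have uv0: "v 0 = u 0"
    using ab[OF zero_in] by (simp add: u_def v_def)
  obtain mu where mu: "mu \<longlonglongrightarrow> 0" "\<And>n. mu n \<ge> 0"
    "\<And>n t. \<lbrakk>n \<ge> 1; t \<in> {0..1}\<rbrakk> \<Longrightarrow> dist (u (hawaiian_loop n t)) (u 0) \<le> mu n"
    using loops_shrink[OF u] by blast
  obtain mv where mv: "mv \<longlonglongrightarrow> 0" "\<And>n. mv n \<ge> 0"
    "\<And>n t. \<lbrakk>n \<ge> 1; t \<in> {0..1}\<rbrakk> \<Longrightarrow> dist (v (hawaiian_loop n t)) (u 0) \<le> mv n"
    using loops_shrink[OF v] unfolding uv0 by blast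
  have "(\<lambda>n. mu n + mv n) \<longlonglongrightarrow> 0"
    using tendsto_add[OF mu(1) mv(1)] by simp
  moreover have "mu n + mv n \<ge> 0" for n
    using mu(2) mv(2) by simp
  ultimately obtain r where r: "r \<longlonglongrightarrow> 0" "\<And>n. mu n + mv n < r n"
    "\<And>n i. \<bar>Re (p i - u 0)\<bar> \<noteq> r n" "\<And>n i. \<bar>Im (p i - u 0)\<bar> \<noteq> r n"
    using generic_radii[of "\<lambda>n. mu n + mv n" p "u 0"] by blast
  have r_pos: "r n > 0" for n
    using r(2)[of n] mu(2)[of n] mv(2)[of n] by linarith
  have "\<exists>W. W \<in> I \<and> homotopic_paths (plane W) (u \<circ> hawaiian_loop n) (v \<circ> hawaiian_loop n)"
    if n: "n \<ge> 1" for n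
  proof -
    obtain W where W: "W \<in> I" "homotopic_paths (plane W) (fst \<circ> (a \<circ> whisker_loop n)) (fst \<circ> (b \<circ> whisker_loop n))"
      using homotopic_paths_shadow[OF loops[OF n]] by blast
    have paths: "path (u \<circ> whisker)" "path (u \<circ> hawaiian_loop n)" "path (v \<circ> hawaiian_loop n)"
      using hawaiian_loop_in_earring[OF n]
      by (auto intro!: path_continuous_image path_whisker path_hawaiian_loop
          continuous_on_subset[OF u] continuous_on_subset[OF v] simp: whisker_def path_image_def)
    have eq: "(v \<circ> whisker) t = (u \<circ> whisker) t" if "t \<in> {0..1}" for t
      using ab[of "whisker t"] that by (simp add: u_def v_def whisker_def)
    have "homotopic_paths (plane W)
        (((u \<circ> whisker) +++ (u \<circ> hawaiian_loop n)) +++ reversepath (u \<circ> whisker))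
        (((v \<circ> whisker) +++ (v \<circ> hawaiian_loop n)) +++ reversepath (v \<circ> whisker))"
      using W(2) by (simp add: u_def v_def whisker_loop_joinpaths path_compose_join path_compose_reversepath o_assoc)
    from homotopic_paths_conjugate_cancel[OF this paths eq]
    have "homotopic_paths (plane W) (u \<circ> hawaiian_loop n) (v \<circ> hawaiian_loop n)"
      using uv0 by (simp add: pathstart_def pathfinish_def whisker_def zero_prod_def)
    then show ?thesis
      using W(1) by blast
  qed
  then obtain W where W: "\<And>n. n \<ge> 1 \<Longrightarrow> W n \<in> I"
      "\<And>n. n \<ge> 1 \<Longrightarrow> homotopic_paths (plane (W n)) (u \<circ> hawaiian_loop n) (v \<circ> hawaiian_loop n)"
    by metis
  define is_hom where "is_hom n h \<longleftrightarrow> continuous_on ({0..1} \<times> {0..1}) h \<and>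
      h \<in> ({0..1} \<times> {0..1}) \<rightarrow> plane (W n) \<and>
      (\<forall>t\<in>{0..1}. h (0, t) = u (hawaiian_loop n t)) \<and> (\<forall>t\<in>{0..1}. h (1, t) = v (hawaiian_loop n t)) \<and>
      (\<forall>s\<in>{0..1::real}. h (s, 0::real) = u 0 \<and> h (s, 1) = u 0)" for n h
  have "\<exists>h. is_hom n h" if "n \<ge> 1" for n
    using W(2)[OF that] unfolding homotopic_paths is_hom_def by (simp add: pathstart_def pathfinish_def)
  then obtain h where "\<And>n. n \<ge> 1 \<Longrightarrow> is_hom n (h n)"
    by metis
  then have h: "n \<ge> 1 \<Longrightarrow> continuous_on ({0..1} \<times> {0..1}) (h n)"
      "n \<ge> 1 \<Longrightarrow> x \<in> {0..1} \<times> {0..1} \<Longrightarrow> h n x \<in> plane (W n)"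
      "n \<ge> 1 \<Longrightarrow> t \<in> {0..1} \<Longrightarrow> h n (0, t) = u (hawaiian_loop n t)"
      "n \<ge> 1 \<Longrightarrow> t \<in> {0..1} \<Longrightarrow> h n (1, t) = v (hawaiian_loop n t)"
      "n \<ge> 1 \<Longrightarrow> t \<in> {0..1} \<Longrightarrow> h n (t, 0) = u 0"
      "n \<ge> 1 \<Longrightarrow> t \<in> {0..1} \<Longrightarrow> h n (t, 1) = u 0" for n x t
    unfolding is_hom_def Pi_iff by blast+
  define H where "H n = square_retract (u 0) (r n) \<circ> h n" for n
  define F where "F n = (if n = 0 then {} else {i \<in> W n. dist (p i) (u 0) \<le> 2 * r n})" for n
  have "(\<lambda>n. 2 * r n) \<longlonglongrightarrow> 2 * 0"
    by (intro tendsto_mult r tendsto_const)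
  then have r2: "(\<lambda>n. 2 * r n) \<longlonglongrightarrow> 0"
    by simp
  have "(\<Union>n. F n) \<in> I"
  proof (rule ideal_null_Union)
    show "F n \<in> I" for n
      using W(1)[of n] by (auto simp: F_def empty_in_ideal intro: ideal_subset)
    show "\<forall>\<^sub>F n in sequentially. p ` F n \<subseteq> ball (u 0) e" if "e > 0" for e
      using order_tendstoD(2)[OF r2 that]
      by (rule eventually_mono) (auto simp: F_def dist_commute)
  qed
  moreover define Wa where "Wa = {i. p i \<in> fst ` a ` whiskered_set}"
  have "Wa \<in> I"
    unfolding Wa_def using a by (intro compact_hits_in_ideal compact_continuous_image compact_whiskered_set)
  ultimately have V: "(\<Union>n. F n) \<union> Wa \<in> I"
    by (rule ideal_Un)
  let ?V = "(\<Union>n. F n) \<union> Wa"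
  have hom: "homotopic_paths (plane ?V) (u \<circ> q) (v \<circ> q)"
  proof (rule whiskered_homotopy[where H = H and \<rho> = "\<lambda>n. 2 * r n"])
    show "u x = v x" if "x \<in> {-1..0} \<times> {0}" for x
      using ab[OF that] by (simp add: u_def v_def)
    show "u ` ({-1..0} \<times> {0}) \<subseteq> plane ?V"
      by (force simp: plane_def Wa_def u_def)
    fix n :: nat assume n: "n \<ge> 1"
    show "continuous_on ({0..1} \<times> {0..1}) (H n)"
      unfolding H_def by (intro continuous_on_compose h n continuous_on_square_retract)
    have id: "square_retract (u 0) (r n) (u (hawaiian_loop n t)) = u (hawaiian_loop n t)"
      "square_retract (u 0) (r n) (v (hawaiian_loop n t)) = v (hawaiian_loop n t)" if "t \<in> {0..1}" for t
      using mu(3)[OF n that] mv(3)[OF n that] r(2)[of n] mu(2)[of n] mv(2)[of n]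
      by (auto intro!: square_retract_id)
    show "H n (0, t) = u (hawaiian_loop n t)" "H n (1, t) = v (hawaiian_loop n t)" if "t \<in> {0..1}" for t
      using that id n h by (auto simp: H_def)
    show "H n (s, t) = u 0" if "s \<in> {0..1}" "t \<in> {0, 1}" for s t
      using that n h(5,6) r_pos[of n] by (auto simp: H_def intro!: square_retract_id)
    show near: "dist (H n x) (u 0) \<le> 2 * r n" if "x \<in> {0..1} \<times> {0..1}" for x
      unfolding H_def o_def using r_pos[of n] by (intro dist_square_retract_le) simp
    show "H n x \<in> plane ?V" if x: "x \<in> {0..1} \<times> {0..1}" for x
    proof -
      have "i \<in> F n" if "H n x = p i" for i
      proof -
        have "h n x = p i"
        proof (rule square_retract_eqD)
          show "square_retract (u 0) (r n) (h n x) = p i"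
            using that by (simp add: H_def)
        qed (use r(3,4) r_pos[of n] in \<open>auto intro: less_imp_le\<close>)
        then have "i \<in> W n"
          using h(2)[OF n x] by (auto simp: plane_def)
        then show ?thesis
          using near[OF x] that n by (simp add: F_def)
      qed
      then show ?thesis
        by (auto simp: plane_def)
    qed
  qed (use u v q r2 in auto)
  then have hom': "homotopic_paths (plane ?V) (fst \<circ> (a \<circ> q)) (fst \<circ> (b \<circ> q))"
    by (simp add: u_def v_def o_assoc)
  have ends: "(b \<circ> q) 0 = (a \<circ> q) 0" "(b \<circ> q) 1 = (a \<circ> q) 1"
    using ab[of whisker_base] q by (auto simp: whisker_base_def)
  show ?thesis
  proof (rule homotopic_paths_tower[OF _ _ _ _ _ _ V hom'])
    show "path (a \<circ> q)" "path (b \<circ> q)"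
      using path_continuous_image[OF q(1) continuous_on_subset[OF a(1) q(2)]]
        path_continuous_image[OF q(1) continuous_on_subset[OF b(1) q(2)]] by blast+
    show "path_image (a \<circ> q) \<subseteq> tower" "path_image (b \<circ> q) \<subseteq> tower"
      using q a b unfolding path_image_def by (auto simp: image_subset_iff)
  qed (use ends in \<open>auto simp: pathstart_def pathfinish_def\<close>)
qed

lemma well_defined_transfinite_pi1_products_tower_copy:
  assumes hom: "homeomorphic_maps Y (top_of_set tower) f g"
  shows "well_defined_transfinite_pi1_products Y y"
proof (rule well_defined_transfinite_pi1_productsI)
  fix a b q
  assume a: "continuous_map whiskered_earring Y a" and b: "continuous_map whiskered_earring Y b"
    and ab: "\<And>t. t \<in> {0..1} \<Longrightarrow> a (whisker t) = b (whisker t)"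
    and loops: "\<And>n. n \<ge> 1 \<Longrightarrow> path_homotopic Y (a \<circ> whisker_loop n) (b \<circ> whisker_loop n)"
    and q: "pathin whiskered_earring q" "q 0 = whisker_base" "q 1 = whisker_base"
  have f: "continuous_map Y (top_of_set tower) f"
    using hom by (simp add: homeomorphic_maps_def)
  have fab: "continuous_map whiskered_earring (top_of_set tower) (f \<circ> a)"
      "continuous_map whiskered_earring (top_of_set tower) (f \<circ> b)"
    using a b f continuous_map_compose by blast+
  have iff: "path_homotopic Y (a \<circ> q) (b \<circ> q) \<longleftrightarrow> homotopic_paths tower (f \<circ> a \<circ> q) (f \<circ> b \<circ> q)"
    if "pathin whiskered_earring q" for q
    using path_homotopic_homeomorphic[OF hom pathin_compose[OF that a] pathin_compose[OF that b]]
    by (simp add: path_homotopic_canon o_assoc)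
  have "homotopic_paths tower (f \<circ> a \<circ> q) (f \<circ> b \<circ> q)"
  proof (rule tower_pi1)
    show "continuous_on whiskered_set (f \<circ> a)" "(f \<circ> a) ` whiskered_set \<subseteq> tower"
      "continuous_on whiskered_set (f \<circ> b)" "(f \<circ> b) ` whiskered_set \<subseteq> tower"
      using fab unfolding whiskered_earring_def by (auto simp: image_subset_iff_funcset)
    show "(f \<circ> a) x = (f \<circ> b) x" if "x \<in> {-1..0} \<times> {0}" for x
      using ab[of "fst x + 1"] that by (auto simp: whisker_def)
    show "homotopic_paths tower (f \<circ> a \<circ> whisker_loop n) (f \<circ> b \<circ> whisker_loop n)" if "n \<ge> 1" for n
      using iff[OF pathin_whisker_loop[OF that]] loops[OF that] by simp
    show "path q" "path_image q \<subseteq> whiskered_set"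
      using q(1) unfolding whiskered_earring_def by (auto simp: pathin_canon_iff path_image_def)
  qed (use q in auto)
  then show "path_homotopic Y (a \<circ> q) (b \<circ> q)"
    using iff[OF q(1)] by simp
qed

end

section \<open>Punctures over a set of positive measure\<close>

lemma exp_logs_same_increment:
  fixes L M :: "'a::topological_space \<Rightarrow> complex"
  assumes "connected S" "continuous_on S L" "continuous_on S M"
    and eq: "\<And>x. x \<in> S \<Longrightarrow> exp (L x) = k * exp (M x)" and xy: "x \<in> S" "y \<in> S"
  shows "L x - L y = M x - M y"
proof -
  have "(\<lambda>x. L x - M x) constant_on S"
  proof (rule continuous_discrete_range_constant[OF assms(1)])
    show "continuous_on S (\<lambda>x. L x - M x)"
      using assms by (intro continuous_intros)
    fix x assume x: "x \<in> S"
    have "2 * pi \<le> norm ((L y - M y) - (L x - M x))" if y: "y \<in> S" "L y - M y \<noteq> L x - M x" for y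
    proof -
      have "exp (L z - M z) = k" if "z \<in> S" for z
        using eq[OF that] by (simp add: exp_diff)
      then have "exp (L y - M y) = exp (L x - M x)"
        using x y by simp
      then have "2 * pi \<le> \<bar>Im (L y - M y) - Im (L x - M x)\<bar>"
        using exp_complex_eqI[of "L y - M y" "L x - M x"] y(2) leI by blast
      then show ?thesis
        using abs_Im_le_cmod[of "(L y - M y) - (L x - M x)"] by simp
    qed
    then show "\<exists>e>0. \<forall>y. y \<in> S \<and> L y - M y \<noteq> L x - M x \<longrightarrow> e \<le> norm ((L y - M y) - (L x - M x))"
      using pi_gt_zero by (intro exI[of _ "2 * pi"]) auto
  qed
  then obtain c where c: "\<And>x. x \<in> S \<Longrightarrow> L x - M x = c"
    unfolding constant_on_def by blast
  show ?thesis
    using c[OF xy(1)] c[OF xy(2)] by (simp add: algebra_simps)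
qed

text \<open>A null homotopy missing the puncture would yield a logarithm with equal values at the two
  ends of the loop. But its imaginary part increases along the lower path (in a half plane) and
  decreases along the upper path (in the complement of a downward ray).\<close>
lemma loop_around_puncture_not_null:
  assumes g: "continuous_on {0..1} g" "g 0 = 0" "g 1 = 0" and s: "0 < s" "s < 1" and h: "0 < h" "h < g s"
  shows "\<not> homotopic_paths (- {Complex s h}) (complex_of_real +++ reversepath (\<lambda>t. Complex t (g t))) (\<lambda>_. 0)"
    (is "\<not> homotopic_paths _ ?c _")
proof
  let ?P = "Complex s h"
  assume "homotopic_paths (- {?P}) ?c (\<lambda>_. 0)"
  then obtain H where H: "continuous_on ({0..1} \<times> {0..1}) H" "H \<in> ({0..1} \<times> {0..1}) \<rightarrow> - {?P}"
    "\<forall>x\<in>{0..1}. H (0, x) = ?c x" "\<forall>x\<in>{0..1}. H (1, x) = 0"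
    "\<forall>t\<in>{0..1::real}. pathstart (H \<circ> Pair t) = pathstart ?c \<and> pathfinish (H \<circ> Pair t) = pathfinish ?c"
    unfolding homotopic_paths by blast
  have "continuous_on ({0..1} \<times> {0..1}) (\<lambda>x. H x - ?P)"
    by (intro continuous_intros H)
  moreover have "contractible ({0..1::real} \<times> {0..1::real})"
    by (intro convex_imp_contractible convex_Times) auto
  moreover have "H x - ?P \<noteq> 0" if "x \<in> {0..1} \<times> {0..1}" for x
    using H(2) that by auto
  ultimately obtain L where L: "continuous_on ({0..1} \<times> {0..1}) L"
      "\<And>x. x \<in> {0..1} \<times> {0..1} \<Longrightarrow> H x - ?P = exp (L x)"
    using continuous_logarithm_on_contractible by blast
  have P0: "?P \<noteq> 0"
    using s by (simp add: complex_eq_iff)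
  have sides: "H (u, 0) = 0" "H (u, 1) = 0" if "u \<in> {0..1}" for u
    using H(5) that g by (auto simp: pathstart_def pathfinish_def joinpaths_def reversepath_def complex_eq_iff)
  have line: "continuous_on {0..1} (\<lambda>t. L (u + t * (u' - u), v + t * (v' - v)))"
    if "u \<in> {0..1}" "u' \<in> {0..1}" "v \<in> {0..1}" "v' \<in> {0..1}" for u u' v v' :: real
  proof (rule continuous_on_compose2[OF L(1)])
    have "u + t * (u' - u) \<in> {0..1}" if "u \<in> {0..1}" "u' \<in> {0..1}" "t \<in> {0..1}" for u u' t :: real
      using convexD_alt[of "{0..1::real}" u u' t] that by (simp add: algebra_simps)
    then show "(\<lambda>t. (u + t * (u' - u), v + t * (v' - v))) ` {0..1} \<subseteq> {0..1} \<times> {0..1}"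
      using that by blast
  qed (intro continuous_intros)
  have const: "L (u, v) = L (u', v')"
    if uv: "u \<in> {0..1}" "u' \<in> {0..1}" "v \<in> {0..1}" "v' \<in> {0..1}"
      and H0: "\<And>t. t \<in> {0..1} \<Longrightarrow> H (u + t * (u' - u), v + t * (v' - v)) = 0" for u u' v v' :: real
  proof -
    have "u + t * (u' - u) \<in> {0..1}" if "u \<in> {0..1}" "u' \<in> {0..1}" "t \<in> {0..1}" for u u' t :: real
      using convexD_alt[of "{0..1::real}" u u' t] that by (simp add: algebra_simps)
    then have "exp (L (u + t * (u' - u), v + t * (v' - v))) = (- ?P) * exp 0" if "t \<in> {0..1}" for t
      using L(2)[of "(u + t * (u' - u), v + t * (v' - v))"] H0[OF that] that uv by simp
    from exp_logs_same_increment[OF _ line[OF uv] continuous_on_const this, of 0 1]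
    show ?thesis
      by simp
  qed
  have "L (0, 0) = L (1, 0)"
    by (rule const) (use sides in auto)
  also have "\<dots> = L (1, 1)"
    by (rule const) (use H(4) in auto)
  also have "\<dots> = L (0, 1)"
    by (rule const) (use sides in auto)
  finally have closed: "L (0, 0) = L (0, 1)" .
  have bottom: "exp (L (0, 0 + t * (1 / 2 - 0))) = - \<i> * exp (Ln (\<i> * (complex_of_real t - ?P)))"
    if t: "t \<in> {0..1}" for t
  proof -
    have "?c (t / 2) = complex_of_real t"
      using t by (simp add: joinpaths_def)
    then have "exp (L (0, 0 + t * (1 / 2 - 0))) = complex_of_real t - ?P"
      using L(2)[of "(0, t / 2)"] H(3) t by simp
    moreover have "complex_of_real t - ?P \<noteq> 0"
      using h by (simp add: complex_eq_iff)
    ultimately show ?thesis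
      by simp
  qed
  have top: "exp (L (0, 1 + t * (1 / 2 - 1))) = \<i> * exp (Ln (- \<i> * (Complex t (g t) - ?P)))"
    if t: "t \<in> {0..1}" for t
  proof -
    have "?c (1 - t / 2) = Complex t (g t)"
      using t g(3) by (auto simp: joinpaths_def reversepath_def complex_eq_iff)
    then have "exp (L (0, 1 + t * (1 / 2 - 1))) = Complex t (g t) - ?P"
      using L(2)[of "(0, 1 - t / 2)"] H(3) t by simp
    moreover have "Complex t (g t) - ?P \<noteq> 0"
      using h by (auto simp: complex_eq_iff)
    ultimately show ?thesis
      by simp
  qed
  have "continuous_on {0..1} (\<lambda>t. Ln (\<i> * (complex_of_real t - ?P)))"
    using h by (intro continuous_intros) (auto simp: complex_nonpos_Reals_iff)
  from exp_logs_same_increment[OF _ _ this bottom, of 1 0] line[of 0 0 0 "1 / 2"]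
  have "L (0, 1 / 2) - L (0, 0) = Ln (\<i> * (1 - ?P)) - Ln (\<i> * (0 - ?P))"
    by simp
  moreover have "continuous_on {0..1} (\<lambda>t. Ln (- \<i> * (Complex t (g t) - ?P)))"
  proof -
    have "- \<i> * (Complex t (g t) - ?P) \<notin> \<real>\<^sub>\<le>\<^sub>0" for t
      using h by (auto simp: complex_nonpos_Reals_iff)
    moreover have "continuous_on {0..1} (\<lambda>t. Complex t (g t))"
      unfolding Complex_eq by (intro continuous_intros g)
    ultimately show ?thesis
      by (intro continuous_intros g) auto
  qed
  from exp_logs_same_increment[OF _ _ this top, of 1 0] line[of 0 0 1 "1 / 2"]
  have "L (0, 1 / 2) - L (0, 1) = Ln (- \<i> * (1 - ?P)) - Ln (- \<i> * (0 - ?P))"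
    using g by (simp add: Complex_eq_1 complex_eq_iff flip: one_complex.code zero_complex.code)
  ultimately have "Ln (\<i> * (1 - ?P)) - Ln (\<i> * (0 - ?P)) = Ln (- \<i> * (1 - ?P)) - Ln (- \<i> * (0 - ?P))"
    using closed by simp
  moreover have Im_pos: "Im (Ln z) > 0" if "Im z > 0" for z
    using Im_Ln_pos_lt[of z] that by fastforce
  moreover have Im_neg: "Im (Ln z) < 0" if "Im z < 0" for z
    using Im_Ln_pos_le[of z] Im_Ln_le_pi[of z] that by fastforce
  moreover have "Im (Ln (\<i> * (1 - ?P))) > 0" "Im (Ln (\<i> * (0 - ?P))) < 0"
      "Im (Ln (- \<i> * (1 - ?P))) < 0" "Im (Ln (- \<i> * (0 - ?P))) > 0"
    by (rule Im_pos Im_neg; use s in simp)+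
  ultimately show False
    unfolding complex_eq_iff minus_complex.sel(2) by linarith
qed

lemma component_interval_ends:
  fixes A :: "real set"
  assumes ab: "{a<..<b} \<in> components ({0..1} - A)"
  shows "a < b" "0 \<le> a" "b \<le> 1" "a \<in> A" "b \<in> A" "{a<..<b} \<inter> A = {}"
proof -
  show ab': "a < b"
    using in_components_nonempty[OF ab] by simp
  have sub: "{a<..<b} \<subseteq> {0..1} - A"
    by (rule in_components_subset[OF ab])
  then show "{a<..<b} \<inter> A = {}"
    by blast
  have "{a..b} \<subseteq> {0..1}"
    using closure_minimal[of "{a<..<b}" "{0..1}"] sub ab' by auto
  then show bounds: "0 \<le> a" "b \<le> 1"
    using ab' by auto
  obtain m where m: "a < m" "m < b"
    using dense[OF ab'] by blast
  show "a \<in> A"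
  proof (rule ccontr)
    assume "a \<notin> A"
    moreover have "{a..<b} = insert a {a<..<b}"
      using ab' by auto
    ultimately have "{a..<b} \<subseteq> {0..1} - A"
      using sub ab' bounds by auto
    moreover have "m \<in> {a<..<b} \<inter> {a..<b}"
      using m by simp
    ultimately have "{a..<b} \<subseteq> {a<..<b}"
      by (intro components_maximal[OF ab]) auto
    then show False
      using ab' by force
  qed
  show "b \<in> A"
  proof (rule ccontr)
    assume "b \<notin> A"
    moreover have "{a<..b} = insert b {a<..<b}"
      using ab' by auto
    ultimately have "{a<..b} \<subseteq> {0..1} - A"
      using sub ab' bounds by auto
    moreover have "m \<in> {a<..<b} \<inter> {a<..b}"
      using m by simp
    ultimately have "{a<..b} \<subseteq> {a<..<b}"
      by (intro components_maximal[OF ab]) auto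
    then show False
      using ab' by force
  qed
qed

definition unit_rat :: "nat \<Rightarrow> real" where
  "unit_rat = from_nat_into ({0<..<1} \<inter> \<rat>)"

lemma range_unit_rat: "range unit_rat = {0<..<1} \<inter> \<rat>"
proof -
  have "(1 / 2 :: real) \<in> {0<..<1} \<inter> \<rat>"
    by simp
  then have "{0<..<1} \<inter> \<rat> \<noteq> ({} :: real set)"
    by blast
  then show ?thesis
    unfolding unit_rat_def using countable_rat by (intro range_from_nat_into) auto
qed

lemma unit_rat_bounds: "0 < unit_rat n" "unit_rat n < 1"
  using range_unit_rat by auto

definition fat_set :: "real set" where
  "fat_set = {0, 1} \<union> ({0..1} - (\<Union>n. ball (unit_rat n) ((1 / 2) ^ (n + 3))))"

lemma closed_fat_set: "closed fat_set"
  unfolding fat_set_def by (intro closed_Un closed_Diff open_UN) auto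

lemma fat_set_bounds: "fat_set \<subseteq> {0..1}" "{0, 1} \<subseteq> fat_set"
  by (auto simp: fat_set_def)

lemma unit_rat_notin_fat_set: "unit_rat n \<notin> fat_set"
proof -
  have "unit_rat n \<in> (\<Union>n. ball (unit_rat n) ((1 / 2) ^ (n + 3)))"
    by (rule UN_I[of n]) auto
  then show ?thesis
    using unit_rat_bounds[of n] unfolding fat_set_def by (simp del: UN_iff)
qed

lemma fat_set_not_negligible: "\<not> negligible fat_set"
proof
  assume N: "negligible fat_set"
  let ?U = "\<lambda>n. ball (unit_rat n) ((1 / 2) ^ (n + 3))"
  have U: "emeasure lebesgue (?U n) = ennreal (1 / 4 * (1 / 2) ^ n)" for n
    by (simp add: ball_eq_greaterThanLessThan power_add power3_eq_cube)
  have "(\<lambda>n. 1 / 4 * (1 / 2 :: real) ^ n) sums (1 / 4 * (1 / (1 - 1 / 2)))"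
    by (intro sums_mult geometric_sums) auto
  then have sum: "(\<Sum>n. emeasure lebesgue (?U n)) = ennreal (1 / 2)"
    unfolding U by (subst suminf_ennreal_eq) auto
  have "ennreal 1 = emeasure lebesgue {0..1::real}"
    by simp
  also have "\<dots> \<le> emeasure lebesgue (fat_set \<union> (\<Union>n. ?U n))"
    using negligible_imp_sets[OF N] by (intro emeasure_mono sets.Un sets.countable_UN) (auto simp: fat_set_def)
  also have "\<dots> \<le> emeasure lebesgue fat_set + emeasure lebesgue (\<Union>n. ?U n)"
    using negligible_imp_sets[OF N] by (intro emeasure_subadditive sets.countable_UN) auto
  also have "\<dots> \<le> 0 + (\<Sum>n. emeasure lebesgue (?U n))"
    using negligible_iff_emeasure0[OF negligible_imp_sets[OF N]] N
    by (intro add_mono emeasure_subadditive_countably) auto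
  also have "\<dots> = ennreal (1 / 2)"
    unfolding sum by simp
  finally have "ennreal 1 \<le> ennreal (1 / 2)" .
  then show False
    by (subst (asm) ennreal_le_iff) auto
qed

definition tent :: "real \<Rightarrow> real" where
  "tent t = infdist t fat_set"

lemma continuous_tent: "continuous_on S tent"
  unfolding tent_def by (intro continuous_intros)

lemma tent_nonneg: "0 \<le> tent t"
  by (simp add: tent_def infdist_nonneg)

lemma tent_eq_0_iff: "tent t = 0 \<longleftrightarrow> t \<in> fat_set"
  unfolding tent_def using in_closed_iff_infdist_zero[OF closed_fat_set] fat_set_bounds by auto

lemma tent_unit_rat_pos: "0 < tent (unit_rat n)"
  using tent_nonneg[of "unit_rat n"] tent_eq_0_iff unit_rat_notin_fat_set by (metis less_eq_real_def)

definition puncture :: "nat \<Rightarrow> complex" where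
  "puncture n = Complex (unit_rat n) (tent (unit_rat n) / 2)"

definition limit_trace :: "complex set \<Rightarrow> real set" where
  "limit_trace S = {t \<in> fat_set. complex_of_real t \<in> closure S}"

definition thin :: "nat set set" where
  "thin = {S. negligible (limit_trace (puncture ` S))}"

lemma limit_trace_mono: "S \<subseteq> T \<Longrightarrow> limit_trace S \<subseteq> limit_trace T"
  unfolding limit_trace_def using closure_mono by blast

lemma limit_trace_null_Union:
  assumes "\<And>e. e > 0 \<Longrightarrow> \<forall>\<^sub>F k in sequentially. F k \<subseteq> ball z e"
  shows "limit_trace (\<Union>k. F k) \<subseteq> insert (Re z) (\<Union>k. limit_trace (F k))"
proof
  fix t assume t: "t \<in> limit_trace (\<Union>k. F k)"
  show "t \<in> insert (Re z) (\<Union>k. limit_trace (F k))"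
  proof (cases "complex_of_real t = z")
    case False
    define e where "e = dist (complex_of_real t) z / 2"
    have e: "e > 0"
      using False by (simp add: e_def)
    obtain N where N: "\<And>k. k \<ge> N \<Longrightarrow> F k \<subseteq> ball z e"
      using assms[OF e] by (auto simp: eventually_sequentially)
    have "(\<Union>k. F k) \<subseteq> (\<Union>k<N. closure (F k)) \<union> cball z e"
    proof
      fix w assume "w \<in> (\<Union>k. F k)"
      then obtain k where k: "w \<in> F k"
        by blast
      show "w \<in> (\<Union>k<N. closure (F k)) \<union> cball z e"
      proof (cases "k < N")
        case True
        then show ?thesis
          using k closure_subset by blast
      next
        case False
        then show ?thesis
          using N[of k] k by (auto simp: less_imp_le)
      qed
    qed
    then have "closure (\<Union>k. F k) \<subseteq> (\<Union>k<N. closure (F k)) \<union> cball z e"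
      by (intro closure_minimal closed_Un closed_UN) auto
    moreover have "complex_of_real t \<notin> cball z e"
      using e by (simp add: e_def dist_commute)
    ultimately show ?thesis
      using t by (auto simp: limit_trace_def)
  qed auto
qed

interpretation thin: puncture_ideal puncture thin
proof
  show "{} \<in> thin"
    by (simp add: thin_def limit_trace_def)
  show "T \<in> thin" if "S \<in> thin" "T \<subseteq> S" for S T
    using that(1) limit_trace_mono[OF image_mono[OF that(2)]] unfolding thin_def mem_Collect_eq
    by (blast intro: negligible_subset)
  show "S \<union> T \<in> thin" if "S \<in> thin" "T \<in> thin" for S T
  proof -
    have "limit_trace (puncture ` (S \<union> T)) = limit_trace (puncture ` S) \<union> limit_trace (puncture ` T)"
      by (auto simp: limit_trace_def image_Un)
    then show ?thesis
      using that by (simp add: thin_def)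
  qed
  show "(\<Union>k. F k) \<in> thin"
    if "\<And>k. F k \<in> thin" "\<And>e. e > 0 \<Longrightarrow> \<forall>\<^sub>F k in sequentially. puncture ` F k \<subseteq> ball z e" for F z
  proof -
    have "negligible (insert (Re z) (\<Union>k. limit_trace (puncture ` F k)))"
      using that(1) by (simp add: thin_def negligible_Union_nat)
    moreover have "limit_trace (puncture ` (\<Union>k. F k)) \<subseteq> insert (Re z) (\<Union>k. limit_trace (puncture ` F k))"
      using limit_trace_null_Union[of "\<lambda>k. puncture ` F k" z] that(2) by (simp add: image_UN)
    ultimately show ?thesis
      unfolding thin_def using negligible_subset by blast
  qed
qed

lemma UNIV_not_thin: "UNIV \<notin> thin"
proof -
  have "complex_of_real t \<in> closure (range puncture)" if t: "t \<in> fat_set" for t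
    unfolding closure_approachable
  proof (intro allI impI)
    fix e :: real assume e: "e > 0"
    have "max 0 (t - e / 2) < min 1 (t + e / 2)"
      using e t fat_set_bounds by auto
    then obtain r where r: "r \<in> \<rat>" "max 0 (t - e / 2) < r" "r < min 1 (t + e / 2)"
      using Rats_dense_in_real by blast
    then have "r \<in> range unit_rat"
      by (simp add: range_unit_rat)
    then obtain n where n: "r = unit_rat n"
      by blast
    have "tent r \<le> dist r t"
      unfolding tent_def by (rule infdist_le[OF t])
    moreover have "dist (puncture n) (complex_of_real t) \<le> \<bar>r - t\<bar> + \<bar>tent r / 2\<bar>"
      unfolding dist_norm using cmod_le[of "puncture n - complex_of_real t"] by (simp add: puncture_def n)
    moreover have "\<bar>r - t\<bar> < e / 2"
      using r unfolding abs_less_iff by auto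
    ultimately have "dist (puncture n) (complex_of_real t) < e"
      using tent_nonneg[of r] by (simp add: dist_real_def)
    then show "\<exists>y\<in>range puncture. dist y (complex_of_real t) < e"
      by blast
  qed
  then have "limit_trace (range puncture) = fat_set"
    by (auto simp: limit_trace_def)
  then show ?thesis
    using fat_set_not_negligible by (simp add: thin_def)
qed

lemma gap_thin:
  assumes "{a<..<b} \<inter> fat_set = {}"
  shows "{n. a < unit_rat n \<and> unit_rat n < b} \<in> thin"
proof -
  let ?S = "{n. a < unit_rat n \<and> unit_rat n < b}"
  have "closure (puncture ` ?S) \<subseteq> {w. Re w \<ge> a} \<inter> {w. Re w \<le> b}"
    by (intro closure_minimal closed_Int closed_halfspace_Re_ge closed_halfspace_Re_le) (auto simp: puncture_def)
  then have "limit_trace (puncture ` ?S) \<subseteq> {a, b}"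
    using assms by (force simp: limit_trace_def)
  then show ?thesis
    unfolding thin_def using negligible_subset[of "{a, b}"] by auto
qed

definition base_path :: "real \<Rightarrow> complex \<times> (nat \<Rightarrow>\<^sub>C real)" where
  "base_path t = (complex_of_real t, 0)"

definition tent_path :: "real \<Rightarrow> complex \<times> (nat \<Rightarrow>\<^sub>C real)" where
  "tent_path t = (Complex t (tent t), 0)"

lemma Im_puncture_pos: "0 < Im (puncture n)"
  by (simp add: puncture_def tent_unit_rat_pos)

lemma base_path_in_tower: "base_path t \<in> thin.tower"
  using Im_puncture_pos by (auto simp: base_path_def thin.mem_tower thin.empty_in_ideal) (metis Im_complex_of_real less_irrefl)

lemma tent_path_in_tower: "tent_path t \<in> thin.tower"
  using tent_unit_rat_pos by (auto simp: tent_path_def thin.mem_tower thin.empty_in_ideal puncture_def)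
    (metis field_sum_of_halves less_add_same_cancel1 less_irrefl half_gt_zero)

lemma path_base_path: "path (subpath a b base_path)"
  unfolding path_def subpath_def base_path_def by (intro continuous_intros)

lemma path_tent_path: "path (subpath a b tent_path)"
proof -
  have "continuous_on {0..1} (\<lambda>x. tent ((b - a) * x + a))"
    by (rule continuous_on_compose2[OF continuous_tent[of UNIV]]) (auto intro!: continuous_intros)
  then show ?thesis
    unfolding path_def subpath_def tent_path_def Complex_eq by (intro continuous_intros)
qed

lemma paths_agree: "t \<in> fat_set \<Longrightarrow> base_path t = tent_path t"
  using tent_eq_0_iff by (simp add: base_path_def tent_path_def complex_eq_iff)

lemma gap_loop_null:
  assumes ab: "{a<..<b} \<in> components ({0..1} - fat_set)"
  shows "homotopic_paths thin.tower
    ((subpath 0 b base_path +++ reversepath (subpath a b tent_path)) +++ reversepath (subpath 0 a base_path))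
    (\<lambda>_. base_path 0)" (is "homotopic_paths _ ?c _")
proof -
  note ends = component_interval_ends[OF ab]
  define W where "W = {n. a < unit_rat n \<and> unit_rat n < b}"
  have W: "W \<in> thin"
    unfolding W_def by (rule gap_thin[OF ends(6)])
  have agree: "tent_path a = base_path a" "tent_path b = base_path b"
    using paths_agree ends by auto
  have c: "path ?c"
    using agree by (simp add: path_base_path path_tent_path)
  have sub_base: "path_image (subpath u v base_path) \<subseteq> range base_path" for u v
    by (auto simp: path_image_def subpath_def)
  have sub_tent: "path_image (subpath a b tent_path) \<subseteq> tent_path ` {a..b}"
    using path_image_subpath[of a b tent_path] ends(1) by simp
  have image: "path_image ?c \<subseteq> range base_path \<union> tent_path ` {a..b}"
    by (intro subset_path_image_join) (use sub_base sub_tent in auto)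
  then have c_tower: "path_image ?c \<subseteq> thin.tower"
    using base_path_in_tower tent_path_in_tower by auto
  define z where "z = fst \<circ> ?c"
  have z: "path z"
    unfolding z_def by (intro path_continuous_image c continuous_intros)
  have z01: "z 0 = 0" "z 1 = 0"
    by (auto simp: z_def joinpaths_def reversepath_def subpath_def base_path_def)
  have segment: "closed_segment (z s) (complex_of_real (Re (z s))) \<subseteq> thin.plane W" if s: "s \<in> {0..1}" for s
  proof
    fix w assume "w \<in> closed_segment (z s) (complex_of_real (Re (z s)))"
    then obtain l where l: "w = (1 - l) *\<^sub>R z s + l *\<^sub>R complex_of_real (Re (z s))"
      by (auto simp: closed_segment_def)
    have "n \<in> W" if n: "w = puncture n" for n
    proof -
      have "?c s \<in> range base_path \<union> tent_path ` {a..b}"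
        using image s unfolding path_image_def by blast
      moreover have "(1 - l) * Im (z s) \<noteq> 0"
        using arg_cong[OF l, of Im] Im_puncture_pos[of n] by (auto simp: n)
      then have "Im (z s) \<noteq> 0"
        by simp
      ultimately obtain t where t: "t \<in> {a..b}" "?c s = tent_path t"
        by (auto simp: z_def base_path_def)
      then have zt: "z s = Complex t (tent t)"
        by (simp add: z_def tent_path_def)
      have "t \<noteq> a" "t \<noteq> b"
        using \<open>Im (z s) \<noteq> 0\<close> zt ends tent_eq_0_iff by auto
      moreover have "Re w = t"
        by (simp add: l zt algebra_simps)
      ultimately show ?thesis
        using t(1) n by (simp add: W_def puncture_def)
    qed
    then show "w \<in> thin.plane W"
      by (auto simp: thin.plane_def)
  qed
  have "homotopic_paths (thin.plane W) z (\<lambda>s. complex_of_real (Re (z s)))"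
  proof (rule homotopic_paths_linear[OF z])
    show "path (\<lambda>s. complex_of_real (Re (z s)))"
      using z unfolding path_def by (intro continuous_intros)
  qed (use segment z01 in \<open>auto simp: pathstart_def pathfinish_def\<close>)
  also have "homotopic_paths (thin.plane W) \<dots> (\<lambda>s. 0)"
  proof (rule homotopic_paths_linear)
    show "path (\<lambda>s. complex_of_real (Re (z s)))"
      using z unfolding path_def by (intro continuous_intros)
    show "closed_segment (complex_of_real (Re (z s))) 0 \<subseteq> thin.plane W" for s
    proof -
      have "Im w = 0" if "w \<in> closed_segment (complex_of_real (Re (z s))) 0" for w
        using that by (auto simp: closed_segment_def)
      moreover have "Im (puncture n) \<noteq> 0" for n
        using Im_puncture_pos[of n] by simp
      ultimately show ?thesis
        unfolding thin.plane_def by blast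
    qed
  qed (use z01 in \<open>auto simp: pathstart_def pathfinish_def path_def\<close>)
  finally have "homotopic_paths (thin.plane W) (fst \<circ> ?c) (fst \<circ> (\<lambda>_. base_path 0))"
    by (simp add: z_def base_path_def o_def)
  from thin.homotopic_paths_tower[OF c c_tower _ _ _ _ W this] show ?thesis
    using base_path_in_tower by (simp add: path_def path_image_def pathstart_def pathfinish_def
        joinpaths_def reversepath_def subpath_def)
qed

lemma full_loop_not_null:
  "\<not> homotopic_paths thin.tower (base_path +++ reversepath tent_path) (\<lambda>_. base_path 0)"
proof
  assume "homotopic_paths thin.tower (base_path +++ reversepath tent_path) (\<lambda>_. base_path 0)"
  then obtain W where W: "W \<in> thin"
    "homotopic_paths (thin.plane W) (fst \<circ> (base_path +++ reversepath tent_path)) (fst \<circ> (\<lambda>_. base_path 0))"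
    using thin.homotopic_paths_shadow by blast
  have eq: "fst \<circ> (base_path +++ reversepath tent_path)
      = complex_of_real +++ reversepath (\<lambda>t. Complex t (tent t))" "fst \<circ> (\<lambda>_. base_path 0) = (\<lambda>_. 0)"
    by (auto simp: fun_eq_iff joinpaths_def reversepath_def base_path_def tent_path_def)
  have "n \<in> W" for n
  proof (rule ccontr)
    assume "n \<notin> W"
    then have "thin.plane W \<subseteq> - {puncture n}"
      by (auto simp: thin.plane_def)
    moreover have "\<not> homotopic_paths (- {puncture n})
        (complex_of_real +++ reversepath (\<lambda>t. Complex t (tent t))) (\<lambda>_. 0)"
      unfolding puncture_def using tent_eq_0_iff fat_set_bounds unit_rat_bounds tent_unit_rat_pos
      by (intro loop_around_puncture_not_null continuous_tent) auto
    ultimately show False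
      using W(2) homotopic_paths_subset unfolding eq by blast
  qed
  then have "W = UNIV"
    by blast
  then show False
    using W(1) UNIV_not_thin by simp
qed

lemma not_well_defined_transfinite_Pi1_products_tower_copy:
  fixes Y :: "'b::real_normed_vector topology"
  assumes hom: "homeomorphic_maps Y (top_of_set thin.tower) f k"
  shows "\<not> well_defined_transfinite_Pi1_products Y (k (base_path 0))"
proof (rule not_well_defined_transfinite_Pi1_productsI[where \<alpha> = "k \<circ> base_path" and \<beta> = "k \<circ> tent_path"])
  have k: "continuous_map (top_of_set thin.tower) Y k"
    using hom by (simp add: homeomorphic_maps_def)
  have paths: "pathin (top_of_set thin.tower) base_path" "pathin (top_of_set thin.tower) tent_path"
    using path_base_path[of 0 1] path_tent_path[of 0 1] base_path_in_tower tent_path_in_tower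
    by (auto simp: pathin_canon_iff)
  show "closed fat_set" "fat_set \<subseteq> {0..1}" "{0, 1} \<subseteq> fat_set"
    using closed_fat_set fat_set_bounds by auto
  show "pathin Y (k \<circ> base_path)" "pathin Y (k \<circ> tent_path)"
    using paths k pathin_compose by blast+
  show "(k \<circ> tent_path) 0 = k (base_path 0)"
    using paths_agree[of 0] fat_set_bounds by simp
  show "(k \<circ> base_path) t = (k \<circ> tent_path) t" if "t \<in> fat_set" for t
    using paths_agree[OF that] by simp
  have sub: "subpath u v (k \<circ> d) = k \<circ> subpath u v d" for u v and d :: "real \<Rightarrow> complex \<times> (nat \<Rightarrow>\<^sub>C real)"
    by (simp add: subpath_def fun_eq_iff)
  show "path_homotopic Y ((subpath 0 b (k \<circ> base_path) +++ reversepath (subpath a b (k \<circ> tent_path)))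
      +++ reversepath (subpath 0 a (k \<circ> base_path))) (\<lambda>_. k (base_path 0))"
    if "{a<..<b} \<in> components ({0..1} - fat_set)" for a b
    using path_homotopic_compose[OF _ k] gap_loop_null[OF that]
    unfolding sub path_compose_reversepath[symmetric] path_compose_join[symmetric] path_homotopic_canon[symmetric]
    by (fastforce simp: o_def)
  show "\<not> path_homotopic Y ((k \<circ> base_path) +++ reversepath (k \<circ> tent_path)) (\<lambda>_. k (base_path 0))"
  proof
    assume "path_homotopic Y ((k \<circ> base_path) +++ reversepath (k \<circ> tent_path)) (\<lambda>_. k (base_path 0))"
    moreover have const: "k \<circ> (\<lambda>_. base_path 0) = (\<lambda>_. k (base_path 0))"
      by auto
    ultimately have *: "path_homotopic Y (k \<circ> (base_path +++ reversepath tent_path)) (k \<circ> (\<lambda>_. base_path 0))"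
      by (simp only: path_compose_join path_compose_reversepath const)
    have "path (base_path +++ reversepath tent_path)"
      using path_base_path[of 0 1] path_tent_path[of 0 1] paths_agree[of 1] fat_set_bounds
      by (simp add: pathfinish_def)
    then have "pathin (top_of_set thin.tower) (base_path +++ reversepath tent_path)"
      using base_path_in_tower tent_path_in_tower
      by (auto simp: pathin_canon_iff joinpaths_def reversepath_def)
    moreover have "pathin (top_of_set thin.tower) (\<lambda>_. base_path 0)"
      using base_path_in_tower by (simp add: pathin_const)
    ultimately have "path_homotopic (top_of_set thin.tower) (base_path +++ reversepath tent_path) (\<lambda>_. base_path 0)"
      using path_homotopic_homeomorphic homeomorphic_maps_sym hom * by blast
    then show False
      using full_loop_not_null by (simp add: path_homotopic_canon)
  qed
qed simp

theorem theorem1p1: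
  shows "\<exists>(M :: real metric) x0. x0 \<in> mspace M \<and>
           path_connected_space (mtopology_of M) \<and>
           locally_path_connected_space (mtopology_of M) \<and>
           well_defined_transfinite_pi1_products (mtopology_of M) x0 \<and>
           \<not> well_defined_transfinite_Pi1_products (mtopology_of M) x0"
proof -
  obtain f :: "(nat \<Rightarrow> real) \<Rightarrow> real" where f: "inj f"
    using nat_real_functions_inject .
  define e where "e = (\<lambda>(z, \<phi> :: nat \<Rightarrow>\<^sub>C real).
    case_nat (Re z) (case_nat (Im z) (apply_bcontfun \<phi>)))"
  have "inj e"
  proof (rule injI)
    fix x y assume eq: "e x = e y"
    obtain z \<phi> w \<psi> where xy: "x = (z, \<phi>)" "y = (w, \<psi>)"
      by fastforce
    have "apply_bcontfun \<phi> n = apply_bcontfun \<psi> n" for n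
      using fun_cong[OF eq, of "Suc (Suc n)"] by (simp add: e_def xy)
    moreover have "z = w"
      using fun_cong[OF eq, of 0] fun_cong[OF eq, of "Suc 0"] by (simp add: e_def xy complex_eq_iff)
    ultimately show "x = y"
      using bcontfun_eqI[of \<phi> \<psi>] xy by simp
  qed
  then have "inj_on (f \<circ> e) thin.tower"
    using inj_compose[OF f] inj_on_subset by blast
  then obtain M :: "real metric" where M: "mspace M = (f \<circ> e) ` thin.tower"
    "homeomorphic_maps (mtopology_of M) (top_of_set thin.tower) (inv_into thin.tower (f \<circ> e)) (f \<circ> e)"
    using metric_copy_on_reals by blast
  then have hom: "mtopology_of M homeomorphic_space top_of_set thin.tower"
    unfolding homeomorphic_space_def by blast
  have "path_connected_space (mtopology_of M)"
    unfolding homeomorphic_path_connected_space[OF hom]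
    using thin.path_connected_tower path_connectedin_def[of euclidean thin.tower] by simp
  moreover have "locally_path_connected_space (mtopology_of M)"
    unfolding homeomorphic_locally_path_connected_space[OF hom] by (rule thin.locally_path_connected_tower)
  moreover have "(f \<circ> e) (base_path 0) \<in> mspace M"
    unfolding M(1) by (intro imageI base_path_in_tower)
  ultimately show ?thesis
    using thin.well_defined_transfinite_pi1_products_tower_copy[OF M(2)]
      not_well_defined_transfinite_Pi1_products_tower_copy[OF M(2)] by blast
qed


end
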